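(* There exists $\delta>0$ such that for all integers $g\ge0$ and $N\ge1$, the series $$F_N^{(g)} = \sum_{d=1}^\infty\frac{z^d}{d!}\sum_{\alpha,\beta\vdash d}\frac{p_\alpha(a_1,\dots,a_N)}{N^{\ell(\alpha)}}\frac{p_\beta(b_1,\dots,b_N)}{N^{\ell(\beta)}}(-1)^{\ell(\alpha)+\ell(\beta)}\vec{H}_g(\alpha,\beta)$$ converges absolutely and uniformly on $\{(z,a,b)\in\mathbb{C}^{2N+1}: |z|\le\delta,\ |a_i|\le1,\ |b_i|\le1\}$, and the series $$G_N^{(g)} = \sum_{d=1}^\infty\frac{z^{2d}}{d!}\sum_{\beta\vdash d}\frac{p_\beta(c_1,\dots,c_N)}{N^{\ell(\beta)}}(-1)^{d+\ell(\beta)}\vec{H}_g(\beta)$$ converges absolutely and uniformly on $\{(z,c)\in\mathbb{C}^{N+1}: |z|\le\delta,\ |c_i|\le1\}$.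
   Context: For $\alpha\vdash d$, $\ell(\alpha)$ is its number of rows and $p_\alpha(x_1,\dots,x_N)=\prod_{i=1}^{\ell(\alpha)}\sum_{j=1}^Nx_j^{\alpha_i}$. Monotone Hurwitz numbers: for $\alpha,\beta\vdash d$ and $r\ge0$, $\vec{H}^r(\alpha,\beta)$ is the number of tuples $(\rho,\tau_1,\dots,\tau_r)$ with $\rho\in\mathrm{S}(d)$ of cycle type $\alpha$, $\tau_s=(i_s\ j_s)$ transpositions with $i_s<j_s$ and $j_1\le\dots\le j_r$, $\rho\tau_1\cdots\tau_r$ of cycle type $\beta$, and $\rho,\tau_1,\dots,\tau_r$ generating a transitive subgroup of $\mathrm{S}(d)$. $\vec{H}_g(\alpha,\beta)=\vec{H}^{2g-2+\ell(\alpha)+\ell(\beta)}(\alpha,\beta)$ (zero if the exponent is negative) and $\vec{H}_g(\beta)=\vec{H}_g((1^d),\beta)$. *)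

theory Defs
  imports
    "HOL-Analysis.Analysis"
    "HOL-Library.Multiset"
    "HOL-Library.FuncSet"
    "HOL-Combinatorics.Orbits"
    "HOL-Algebra.Sym_Groups"
begin

text \<open>A partition is the multiset of its (positive) parts, so \<open>\<ell>(\<alpha>)\<close> is \<open>size \<alpha>\<close> and
  \<open>(1\<^sup>d)\<close> is \<open>replicate_mset d 1\<close>.\<close>

definition int_partitions :: "nat \<Rightarrow> nat multiset set" where
  "int_partitions d = {\<alpha>. 0 \<notin># \<alpha> \<and> sum_mset \<alpha> = d}"

definition power_sum_poly :: "nat \<Rightarrow> (nat \<Rightarrow> complex) \<Rightarrow> nat multiset \<Rightarrow> complex" where
  "power_sum_poly N x \<alpha> = (\<Prod>k\<in>#\<alpha>. \<Sum>j\<in>{1..N}. x j ^ k)"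

text \<open>Fixed points are counted: \<open>Orbits.orbit \<sigma> x = {x}\<close> when \<open>\<sigma> x = x\<close>.\<close>

definition cycle_type :: "nat \<Rightarrow> (nat \<Rightarrow> nat) \<Rightarrow> nat multiset" where
  "cycle_type d \<sigma> = image_mset card (mset_set (Orbits.orbit \<sigma> ` {1..d}))"

definition generates_transitive :: "nat \<Rightarrow> (nat \<Rightarrow> nat) set \<Rightarrow> bool" where
  "generates_transitive d S \<longleftrightarrow>
     (\<forall>x\<in>{1..d}. \<forall>y\<in>{1..d}. \<exists>\<sigma>\<in>generate (sym_group d) S. \<sigma> x = y)"

definition monotone_transpositions :: "nat \<Rightarrow> nat \<Rightarrow> (nat \<Rightarrow> nat) list set" where
  "monotone_transpositions d r =
     {map (\<lambda>(i, j). Transposition.transpose i j) ps | ps.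
        length ps = r \<and> (\<forall>(i, j)\<in>set ps. 1 \<le> i \<and> i < j \<and> j \<le> d) \<and> sorted (map snd ps)}"

text \<open>The product \<open>\<rho>\<tau>\<^sub>1\<cdots>\<tau>\<^sub>r\<close> is read as composition of functions. Reading it in the
  opposite order gives the same count, through the bijection \<open>\<rho> \<mapsto> \<rho>\<^sup>-\<^sup>1\<close>.\<close>

definition monotone_factorizations ::
    "nat \<Rightarrow> nat \<Rightarrow> nat multiset \<Rightarrow> nat multiset \<Rightarrow> ((nat \<Rightarrow> nat) \<times> (nat \<Rightarrow> nat) list) set" where
  "monotone_factorizations d r \<alpha> \<beta> =
     {(\<rho>, \<tau>s). \<rho> permutes {1..d} \<and> cycle_type d \<rho> = \<alpha> \<and>
        \<tau>s \<in> monotone_transpositions d r \<and>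
        cycle_type d (foldl (\<circ>) \<rho> \<tau>s) = \<beta> \<and>
        generates_transitive d (insert \<rho> (set \<tau>s))}"

text \<open>The degree \<open>d\<close> is recovered from \<open>\<alpha> \<turnstile> d\<close> as \<open>sum_mset \<alpha>\<close>.\<close>

definition monotone_hurwitz_r :: "nat \<Rightarrow> nat multiset \<Rightarrow> nat multiset \<Rightarrow> nat" where
  "monotone_hurwitz_r r \<alpha> \<beta> = card (monotone_factorizations (sum_mset \<alpha>) r \<alpha> \<beta>)"

definition monotone_hurwitz :: "nat \<Rightarrow> nat multiset \<Rightarrow> nat multiset \<Rightarrow> nat" where
  "monotone_hurwitz g \<alpha> \<beta> =
     (if 2 * g + size \<alpha> + size \<beta> < 2 then 0
      else monotone_hurwitz_r (2 * g + size \<alpha> + size \<beta> - 2) \<alpha> \<beta>)"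

definition monotone_hurwitz_single :: "nat \<Rightarrow> nat multiset \<Rightarrow> nat" where
  "monotone_hurwitz_single g \<beta> = monotone_hurwitz g (replicate_mset (sum_mset \<beta>) 1) \<beta>"

definition F_term ::
    "nat \<Rightarrow> nat \<Rightarrow> nat \<Rightarrow> complex \<times> (nat \<Rightarrow> complex) \<times> (nat \<Rightarrow> complex) \<Rightarrow> complex" where
  "F_term g N d = (\<lambda>(z, a, b). z ^ d / fact d *
     (\<Sum>\<alpha>\<in>int_partitions d. \<Sum>\<beta>\<in>int_partitions d.
        power_sum_poly N a \<alpha> / of_nat N ^ size \<alpha> *
        (power_sum_poly N b \<beta> / of_nat N ^ size \<beta>) *
        (-1) ^ (size \<alpha> + size \<beta>) * of_nat (monotone_hurwitz g \<alpha> \<beta>)))"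

definition G_term :: "nat \<Rightarrow> nat \<Rightarrow> nat \<Rightarrow> complex \<times> (nat \<Rightarrow> complex) \<Rightarrow> complex" where
  "G_term g N d = (\<lambda>(z, c). z ^ (2 * d) / fact d *
     (\<Sum>\<beta>\<in>int_partitions d.
        power_sum_poly N c \<beta> / of_nat N ^ size \<beta> *
        (-1) ^ (d + size \<beta>) * of_nat (monotone_hurwitz_single g \<beta>)))"

text \<open>Absolute and uniform convergence on \<open>K\<close> of the series \<open>\<Sum>\<^sub>d\<^sub>\<ge>\<^sub>1 f\<^sub>d\<close>, which starts at
  \<open>d = 1\<close> (the value \<open>f 0\<close> is not used).\<close>

definition abs_unif_convergent_on :: "'a set \<Rightarrow> (nat \<Rightarrow> 'a \<Rightarrow> complex) \<Rightarrow> bool" where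
  "abs_unif_convergent_on K f \<longleftrightarrow>
     (\<forall>x\<in>K. summable (\<lambda>d. norm (f (Suc d) x))) \<and>
     uniformly_convergent_on K (\<lambda>n x. \<Sum>d=1..n. f d x)"

text \<open>The closed unit polydisc of \<open>\<complex>\<^sup>N\<close>. As \<open>N\<close> varies inside the statement, a vector is an
  extensional function on \<open>{1..N}\<close>.\<close>

definition unit_polydisc :: "nat \<Rightarrow> (nat \<Rightarrow> complex) set" where
  "unit_polydisc N = (\<Pi>\<^sub>E i\<in>{1..N}. {w. norm w \<le> 1})"

text \<open>The sums and cardinalities above range over finite sets, so none takes the default value
  \<open>0\<close>.\<close>

lemma finite_int_partitions: "finite (int_partitions d)"
proof (rule finite_subset)
  show "int_partitions d \<subseteq> mset ` {xs. set xs \<subseteq> {1..d} \<and> length xs \<le> d}"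
  proof
    fix \<alpha> assume "\<alpha> \<in> int_partitions d"
    then have nz: "0 \<notin># \<alpha>" and s: "sum_mset \<alpha> = d"
      by (auto simp: int_partitions_def)
    obtain xs where xs: "\<alpha> = mset xs" by (metis ex_mset)
    have "sum_list xs = d" using s xs by (simp add: sum_mset_sum_list)
    then have "x \<le> d" if "x \<in> set xs" for x
      using member_le_sum_list[OF that] by simp
    moreover have "length xs \<le> sum_list xs" if "0 \<notin> set xs" for xs :: "nat list"
      using that by (induction xs) auto
    ultimately show "\<alpha> \<in> mset ` {xs. set xs \<subseteq> {1..d} \<and> length xs \<le> d}"
      using nz xs \<open>sum_list xs = d\<close>
      by (auto simp: image_iff Suc_le_eq intro!: exI[of _ xs] gr0I)
  qed
  show "finite (mset ` {xs. set xs \<subseteq> {1..d} \<and> length xs \<le> d})"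
    by (intro finite_imageI finite_lists_length_le) simp
qed

lemma finite_monotone_factorizations: "finite (monotone_factorizations d r \<alpha> \<beta>)"
proof (rule finite_subset)
  let ?P = "{ps. set ps \<subseteq> {1..d} \<times> {1..d} \<and> length ps = r}"
  let ?T = "map (\<lambda>(i, j). Transposition.transpose i j) ` ?P"
  show "monotone_factorizations d r \<alpha> \<beta> \<subseteq> {\<rho>. \<rho> permutes {1..d}} \<times> ?T"
    unfolding monotone_factorizations_def monotone_transpositions_def by fastforce
  show "finite ({\<rho>. \<rho> permutes {1..d}} \<times> ?T)"
    by (intro finite_cartesian_product finite_imageI finite_lists_length_eq finite_permutations)
      auto
qed

end

theory Submission
  imports Defs "HOL-Library.Disjoint_Sets"
begin

text \<open>
  Only the exponential growth in \<open>d\<close> of \<open>\<Sum>\<^sub>\<alpha>\<^sub>,\<^sub>\<beta> H\<^sub>g(\<alpha>, \<beta>) / d!\<close> matters, with a rate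
  independent of \<open>g\<close>. Multiply \<open>\<rho>\<close> successively by the transpositions and
  keep track of the current permutation \<open>\<pi>\<close> together with the orbit partition \<open>P\<close> of the group
  generated so far. There is a potential \<open>\<Psi>(\<pi>, P)\<close>, a product of weights of the cycles of \<open>\<pi>\<close> and of
  the blocks of \<open>P\<close>, such that for fixed \<open>j\<close> the sum of \<open>\<Psi>\<close> over all next steps \<open>(i j)\<close> is at most
  \<open>9 d\<^sup>2 \<Psi>(\<pi>, P)\<close>. Monotonicity leaves only \<open>2\<^sup>r\<^sup>+\<^sup>d\<close> choices for the larger entries \<open>j\<close>. Comparing \<open>\<Psi>\<close> at
  the start, \<open>d\<^sup>-\<^sup>\<ell>\<^sup>(\<^sup>\<alpha>\<^sup>)\<close>, with a lower bound at a transitive end, the powers of \<open>d\<close> cancel up to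
  \<open>d\<^sup>4\<^sup>g d\<^sup>\<ell>\<^sup>(\<^sup>\<alpha>\<^sup>)\<close>, and \<open>\<Sum>\<^sub>\<rho> d\<^sup>\<ell>\<^sup>(\<^sup>\<rho>\<^sup>) = d (d + 1) \<cdots> (2 d - 1) \<le> 4\<^sup>d d!\<close>.
\<close>

section \<open>Cycles of a permutation multiplied by a transposition\<close>

text \<open>Uniting every block that meets \<open>x\<close> or \<open>y\<close> avoids choosing
  blocks and also covers the case where both points already share a block: then the partition stays
  as it is.\<close>

definition merge_blocks :: "'a \<Rightarrow> 'a \<Rightarrow> 'a set set \<Rightarrow> 'a set set" where
  "merge_blocks x y P = insert (\<Union>{B\<in>P. x \<in> B \<or> y \<in> B}) {B\<in>P. x \<notin> B \<and> y \<notin> B}"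

lemma partition_on_block_unique:
  assumes "partition_on A P" "B \<in> P" "C \<in> P" "x \<in> B" "x \<in> C"
  shows "B = C"
  using disjointD[OF partition_onD2[OF assms(1)] assms(2,3)] assms(4,5) by blast

lemma partition_on_obtain_block:
  assumes "partition_on A P" "x \<in> A"
  obtains B where "B \<in> P" "x \<in> B"
  using partition_onD1[OF assms(1)] assms(2) that by blast

lemma merge_blocks_eq:
  assumes "partition_on A P" "B \<in> P" "x \<in> B" "C \<in> P" "y \<in> C"
  shows "merge_blocks x y P = insert (B \<union> C) (P - {B, C})"
proof -
  note u = partition_on_block_unique[OF assms(1)]
  have "{D\<in>P. x \<in> D \<or> y \<in> D} = {B, C}"
    using assms(2-) u by blast
  moreover have "{D\<in>P. x \<notin> D \<and> y \<notin> D} = P - {B, C}"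
    using assms(2-) u by blast
  ultimately show ?thesis
    unfolding merge_blocks_def by simp
qed

lemma partition_on_merge_blocks:
  assumes P: "partition_on A P" and xy: "x \<in> A" "y \<in> A"
  shows "partition_on A (merge_blocks x y P)"
proof -
  obtain B C where B: "B \<in> P" "x \<in> B" and C: "C \<in> P" "y \<in> C"
    using partition_on_obtain_block[OF P] xy by metis
  note u = partition_on_block_unique[OF P]
  show ?thesis
    unfolding merge_blocks_eq[OF P B C]
  proof (rule partition_onI)
    show "\<Union>(insert (B \<union> C) (P - {B, C})) = A"
      using partition_onD1[OF P] B C by blast
    show "{} \<notin> insert (B \<union> C) (P - {B, C})"
      using B partition_onD3[OF P] by auto
    show "disjnt p q"
      if "p \<in> insert (B \<union> C) (P - {B, C})" "q \<in> insert (B \<union> C) (P - {B, C})" "p \<noteq> q" for p q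
    proof (rule ccontr)
      assume "\<not> disjnt p q"
      then obtain z where z: "z \<in> p" "z \<in> q"
        by (auto simp: disjnt_iff)
      have h: "R = B \<or> R = C" if "R \<in> P" "z \<in> R" "z \<in> B \<union> C" for R
        using u[OF that(1) B(1) that(2)] u[OF that(1) C(1) that(2)] that(3) by auto
      show False
        using that z h[of p] h[of q] u[of p q z] by auto
    qed
  qed
qed

lemma merge_blocks_same:
  assumes "partition_on A P" "B \<in> P" "x \<in> B" "y \<in> B"
  shows "merge_blocks x y P = P"
  using merge_blocks_eq[OF assms(1-3,2,4)] assms(2) by auto

text \<open>Two old factors give way to one new factor. The identity is free of division, so it
  holds in any commutative monoid; it serves for the weights of cycles and for those of
  blocks.\<close>

lemma prod_merge_blocks:
  fixes w :: "'a set \<Rightarrow> 'b::comm_monoid_mult"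
  assumes P: "partition_on A P" and "finite A"
    and B: "B \<in> P" "x \<in> B" and C: "C \<in> P" "y \<in> C" and "B \<noteq> C"
  shows "prod w (merge_blocks x y P) * (w B * w C) = prod w P * w (B \<union> C)"
proof -
  have fin: "finite P"
    using finite_elements[OF \<open>finite A\<close> P] .
  have "B \<union> C \<notin> P - {B, C}"
    using partition_on_block_unique[OF P _ B(1) _ B(2)] B(2) by blast
  then have "prod w (merge_blocks x y P) = w (B \<union> C) * prod w (P - {B, C})"
    unfolding merge_blocks_eq[OF P B C] using fin by simp
  moreover have "prod w P = prod w (P - {B, C}) * (w B * w C)"
    using prod.subset_diff[of "{B, C}" P w] B C fin \<open>B \<noteq> C\<close> by simp
  ultimately show ?thesis
    by (simp add: ac_simps)
qed

lemma card_merge_blocks: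
  assumes P: "partition_on A P" and "finite A"
    and B: "B \<in> P" "x \<in> B" and C: "C \<in> P" "y \<in> C" and "B \<noteq> C"
  shows "Suc (card (merge_blocks x y P)) = card P"
proof -
  have fin: "finite P"
    using finite_elements[OF \<open>finite A\<close> P] .
  have "B \<union> C \<notin> P - {B, C}"
    using partition_on_block_unique[OF P _ B(1) _ B(2)] B(2) by blast
  then have "card (merge_blocks x y P) = Suc (card (P - {B, C}))"
    unfolding merge_blocks_eq[OF P B C] using fin by simp
  moreover have "card (P - {B, C}) = card P - 2"
    using B C \<open>B \<noteq> C\<close> by (subst card_Diff_subset) auto
  moreover have "card {B, C} \<le> card P"
    using fin B C by (intro card_mono) auto
  ultimately show ?thesis
    using \<open>B \<noteq> C\<close> by simp
qed

section \<open>The cycles of a permutation as a set partition\<close>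

definition cycle_sets :: "'a set \<Rightarrow> ('a \<Rightarrow> 'a) \<Rightarrow> 'a set set" where
  "cycle_sets A \<pi> = orbit \<pi> ` A"

lemma self_in_orbit_permutes:
  assumes "\<pi> permutes A" "finite A"
  shows "x \<in> orbit \<pi> x"
  by (rule permutation_self_in_orbit) (use assms in \<open>auto simp: permutation_permutes\<close>)

lemma orbit_eq_if_in_orbit:
  assumes "\<pi> permutes A" "finite A" "y \<in> orbit \<pi> x"
  shows "orbit \<pi> y = orbit \<pi> x"
  by (rule orbit_cyclic_eq3[OF cyclic_on_orbit[OF assms(1,2)] assms(3)])

lemma partition_on_cycle_sets:
  assumes "\<pi> permutes A" "finite A"
  shows "partition_on A (cycle_sets A \<pi>)"
proof (rule partition_onI)
  show "\<Union>(cycle_sets A \<pi>) = A"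
    unfolding cycle_sets_def
    using permutes_orbit_subset[OF assms(1)] self_in_orbit_permutes[OF assms] by blast
  show "{} \<notin> cycle_sets A \<pi>"
    using orbit_nonempty by (metis cycle_sets_def imageE)
  show "disjnt p q" if "p \<in> cycle_sets A \<pi>" "q \<in> cycle_sets A \<pi>" "p \<noteq> q" for p q
  proof -
    from that(1,2) obtain x y where xy: "p = orbit \<pi> x" "q = orbit \<pi> y"
      unfolding cycle_sets_def by blast
    then show ?thesis
      using that(3) orbit_eq_if_in_orbit[OF assms, of _ x] orbit_eq_if_in_orbit[OF assms, of _ y]
      unfolding disjnt_iff by metis
  qed
qed

text \<open>Meant for \<sigma> = \<pi> (x y): the first step from \<open>x\<close> lands where \<pi>
  sends \<open>y\<close>, and from there both walks coincide as long as the two maps agree along the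
  way.\<close>

lemma funpow_agree:
  assumes "\<sigma> x = \<pi> y" and "\<And>m. 0 < m \<Longrightarrow> m < k \<Longrightarrow> \<sigma> ((\<pi> ^^ m) y) = \<pi> ((\<pi> ^^ m) y)"
    and "0 < m" "m \<le> k"
  shows "(\<sigma> ^^ m) x = (\<pi> ^^ m) y"
  using assms(3,4)
proof (induction m)
  case (Suc m)
  then show ?case
    using assms(1,2) by (cases "m = 0") auto
qed simp

text \<open>The product sends \<open>x\<close> to \<pi> y and then follows \<pi> around the whole
  cycle of \<open>y\<close>: that walk avoids \<open>x\<close>, which lies in another cycle, and
  meets \<open>y\<close> only at its end.\<close>

lemma orbit_transpose_subset:
  assumes "\<pi> permutes A" "finite A" "y \<notin> orbit \<pi> x"
  shows "orbit \<pi> y \<subseteq> orbit (\<pi> \<circ> Transposition.transpose x y) x"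
proof
  fix z assume z: "z \<in> orbit \<pi> y"
  define L where "L = funpow_dist1 \<pi> y y"
  have y: "y \<in> orbit \<pi> y"
    by (rule self_in_orbit_permutes[OF assms(1,2)])
  have x: "x \<notin> orbit \<pi> y"
    using orbit_eq_if_in_orbit[OF assms(1,2), of x y] assms(3) y by auto
  have agree: "((\<pi> \<circ> Transposition.transpose x y) ^^ m) x = (\<pi> ^^ m) y" if "0 < m" "m \<le> L" for m
  proof (rule funpow_agree[where k = L])
    fix m assume m: "0 < m" "m < L"
    have "(\<pi> ^^ m) y \<noteq> y"
      using funpow_dist1_least m unfolding L_def by metis
    moreover have "(\<pi> ^^ m) y \<noteq> x"
      using funpow_in_orbit[OF y] x by metis
    ultimately show "(\<pi> \<circ> Transposition.transpose x y) ((\<pi> ^^ m) y) = \<pi> ((\<pi> ^^ m) y)"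
      by simp
  qed (use that in auto)
  have "(\<pi> ^^ L) y = y"
    unfolding L_def using funpow_dist1_prop[OF y] .
  then obtain m where m: "m < L" "z = (\<pi> ^^ m) y"
    using z orbit_altdef_bounded[of L \<pi> y] by (auto simp: L_def)
  show "z \<in> orbit (\<pi> \<circ> Transposition.transpose x y) x"
  proof (cases "m = 0")
    case True
    then have "z = ((\<pi> \<circ> Transposition.transpose x y) ^^ L) x"
      using m agree[of L] \<open>(\<pi> ^^ L) y = y\<close> by simp
    moreover have "0 < L"
      using m by simp
    ultimately show ?thesis
      unfolding orbit_altdef by blast
  next
    case False
    then show ?thesis
      using m agree[of m] unfolding orbit_altdef by force
  qed
qed

lemma permutes_comp_transpose:
  assumes "\<pi> permutes A" "x \<in> A" "y \<in> A"
  shows "\<pi> \<circ> Transposition.transpose x y permutes A"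
  using permutes_compose[OF permutes_swap_id[OF assms(2,3)] assms(1)] .

lemma orbit_comp_transpose_other:
  assumes "\<pi> permutes A" "finite A" "x \<notin> orbit \<pi> z" "y \<notin> orbit \<pi> z"
  shows "orbit (\<pi> \<circ> Transposition.transpose x y) z = orbit \<pi> z"
proof (rule orbit_cong[OF self_in_orbit_permutes[OF assms(1,2)]])
  fix s assume "s \<in> orbit \<pi> z"
  then show "(\<pi> \<circ> Transposition.transpose x y) s = \<pi> s"
    using assms(3,4) by (cases "s = x"; cases "s = y") auto
qed

text \<open>Each of the two points traverses the cycle of the other one, which gives one inclusion,
  with the roles of \<open>x\<close> and \<open>y\<close> exchanged for the second half. Conversely,
  the union of the two cycles is closed under the product.\<close>

lemma orbit_comp_transpose_join:
  assumes p: "\<pi> permutes A" "finite A" and xy: "x \<in> A" "y \<in> A" "y \<notin> orbit \<pi> x"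
  shows "orbit (\<pi> \<circ> Transposition.transpose x y) x = orbit \<pi> x \<union> orbit \<pi> y"
    and "orbit (\<pi> \<circ> Transposition.transpose x y) y = orbit \<pi> x \<union> orbit \<pi> y"
proof -
  let ?\<sigma> = "\<pi> \<circ> Transposition.transpose x y"
  note p' = permutes_comp_transpose[OF p(1) xy(1,2)] p(2)
  have y: "x \<notin> orbit \<pi> y"
    using orbit_eq_if_in_orbit[OF p, of x y] self_in_orbit_permutes[OF p] xy(3) by blast
  have 1: "orbit \<pi> y \<subseteq> orbit ?\<sigma> x"
    by (rule orbit_transpose_subset[OF p xy(3)])
  have "orbit \<pi> x \<subseteq> orbit (\<pi> \<circ> Transposition.transpose y x) y"
    by (rule orbit_transpose_subset[OF p y])
  then have 2: "orbit \<pi> x \<subseteq> orbit ?\<sigma> y"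
    by (simp add: transpose_commute)
  have "y \<in> orbit ?\<sigma> x"
    using 1 self_in_orbit_permutes[OF p] by blast
  then have 3: "orbit ?\<sigma> y = orbit ?\<sigma> x"
    by (rule orbit_eq_if_in_orbit[OF p'])
  have 4: "orbit ?\<sigma> x \<subseteq> orbit \<pi> x \<union> orbit \<pi> y"
  proof
    fix z assume "z \<in> orbit ?\<sigma> x"
    then show "z \<in> orbit \<pi> x \<union> orbit \<pi> y"
    proof induction
      case base
      then show ?case by (simp add: orbit.base)
    next
      case (step z)
      then show ?case
        using orbit.base[of \<pi>] orbit.step[of z \<pi>]
        by (cases "z = x"; cases "z = y") auto
    qed
  qed
  show "orbit ?\<sigma> x = orbit \<pi> x \<union> orbit \<pi> y" "orbit ?\<sigma> y = orbit \<pi> x \<union> orbit \<pi> y"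
    using 1 2 3 4 by blast+
qed

lemma cycle_sets_comp_transpose_join:
  assumes p: "\<pi> permutes A" "finite A" and xy: "x \<in> A" "y \<in> A" "y \<notin> orbit \<pi> x"
  shows "cycle_sets A (\<pi> \<circ> Transposition.transpose x y) = merge_blocks x y (cycle_sets A \<pi>)"
proof -
  let ?\<sigma> = "\<pi> \<circ> Transposition.transpose x y"
  note self = self_in_orbit_permutes[OF p]
  note eq = orbit_eq_if_in_orbit[OF p]
  have m: "merge_blocks x y (cycle_sets A \<pi>) =
      insert (orbit \<pi> x \<union> orbit \<pi> y) (cycle_sets A \<pi> - {orbit \<pi> x, orbit \<pi> y})"
    by (rule merge_blocks_eq[OF partition_on_cycle_sets[OF p]])
      (use xy self in \<open>auto simp: cycle_sets_def\<close>)
  have other: "orbit ?\<sigma> z = orbit \<pi> z" if "z \<notin> orbit \<pi> x" "z \<notin> orbit \<pi> y" for z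
    using that eq[of x z] eq[of y z] self[of z] by (intro orbit_comp_transpose_other[OF p]) auto
  have join: "orbit ?\<sigma> z = orbit \<pi> x \<union> orbit \<pi> y" if "z \<in> orbit \<pi> x \<union> orbit \<pi> y" for z
    using orbit_comp_transpose_join[OF p xy] that
      orbit_eq_if_in_orbit[OF permutes_comp_transpose[OF p(1) xy(1,2)] p(2), of z x] by simp
  have iff: "orbit \<pi> z = orbit \<pi> u \<longleftrightarrow> z \<in> orbit \<pi> u" for z u
    using eq self by metis
  show ?thesis
    unfolding m
  proof (intro equalityI subsetI)
    fix B assume "B \<in> cycle_sets A ?\<sigma>"
    then obtain z where z: "z \<in> A" "B = orbit ?\<sigma> z"
      by (auto simp: cycle_sets_def)
    show "B \<in> insert (orbit \<pi> x \<union> orbit \<pi> y) (cycle_sets A \<pi> - {orbit \<pi> x, orbit \<pi> y})"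
    proof (cases "z \<in> orbit \<pi> x \<union> orbit \<pi> y")
      case True
      then show ?thesis using join z by simp
    next
      case False
      then show ?thesis using other[of z] z iff by (auto simp: cycle_sets_def)
    qed
  next
    fix B assume "B \<in> insert (orbit \<pi> x \<union> orbit \<pi> y) (cycle_sets A \<pi> - {orbit \<pi> x, orbit \<pi> y})"
    then consider "B = orbit \<pi> x \<union> orbit \<pi> y" | z where "z \<in> A" "B = orbit \<pi> z"
      "orbit \<pi> z \<noteq> orbit \<pi> x" "orbit \<pi> z \<noteq> orbit \<pi> y"
      by (auto simp: cycle_sets_def)
    then show "B \<in> cycle_sets A ?\<sigma>"
    proof cases
      case 1
      then show ?thesis
        using orbit_comp_transpose_join(1)[OF p xy] xy(1) by (auto simp: cycle_sets_def)
    next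
      case 2
      then show ?thesis
        using other[of z] iff by (auto simp: cycle_sets_def)
    qed
  qed
qed

lemma funpow_dist_less_card_orbit:
  assumes "x \<in> orbit \<pi> x" "y \<in> orbit \<pi> x"
  shows "funpow_dist \<pi> x y < card (orbit \<pi> x)"
proof -
  have c: "card (orbit \<pi> x) = funpow_dist1 \<pi> x x"
    by (subst orbit_conv_funpow_dist1[OF assms(1)], subst card_image[OF inj_on_funpow_dist1])
      (use assms in auto)
  obtain n where n: "n < funpow_dist1 \<pi> x x" "y = (\<pi> ^^ n) x"
    using assms(2) orbit_conv_funpow_dist1[OF assms(1)] by auto
  have "funpow_dist \<pi> x y \<le> n"
    unfolding funpow_dist_def by (rule Least_le) (simp add: n)
  then show ?thesis
    using n c by simp
qed

text \<open>The distance from \<open>y\<close> determines \<open>x\<close> in its orbit, and it is the length of one of the two cycles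
  into which multiplication by \<open>(x y)\<close> cuts that orbit. So the cuts at a given \<open>y\<close> are
  indexed by the length of one piece.\<close>

lemma orbit_comp_transpose_cut:
  assumes p: "\<pi> permutes A" "finite A" and xy: "x \<in> A" "y \<in> A" "x \<noteq> y" "x \<in> orbit \<pi> y"
  shows "y \<notin> orbit (\<pi> \<circ> Transposition.transpose x y) x"
    and "card (orbit (\<pi> \<circ> Transposition.transpose x y) x) = funpow_dist \<pi> y x"
proof -
  let ?\<sigma> = "\<pi> \<circ> Transposition.transpose x y"
  define k where "k = funpow_dist \<pi> y x"
  have k0: "k > 0"
    using funpow_dist_0_eq[OF xy(4)] xy(3) by (auto simp: k_def)
  have kx: "(\<pi> ^^ k) y = x"
    unfolding k_def by (rule funpow_dist_prop[OF xy(4)])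
  have y: "y \<in> orbit \<pi> y"
    by (rule self_in_orbit_permutes[OF p])
  have c: "card (orbit \<pi> y) = funpow_dist1 \<pi> y y"
    by (subst orbit_conv_funpow_dist1[OF y], subst card_image[OF inj_on_funpow_dist1]) (use y in auto)
  have kL: "k < funpow_dist1 \<pi> y y"
    using funpow_dist_less_card_orbit[OF y xy(4)] c by (simp add: k_def)
  have neq: "(\<pi> ^^ m) y \<noteq> y" if "0 < m" "m \<le> k" for m
    using funpow_dist1_least[of m \<pi> y y] that kL by simp
  have inj: "inj_on (\<lambda>m. (\<pi> ^^ m) y) {0..k}"
    using inj_on_funpow_dist[OF xy(4)] by (simp add: k_def)
  \<comment> \<open>The walk of the product from \<open>x\<close> follows \<pi> from \<pi> y until
    it reaches \<open>x\<close> at time \<open>k\<close>, and there it closes up.\<close>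
  have agree: "(?\<sigma> ^^ m) x = (\<pi> ^^ m) y" if "0 < m" "m \<le> k" for m
  proof (rule funpow_agree[where k = k])
    fix m assume m: "0 < m" "m < k"
    have "(\<pi> ^^ m) y \<noteq> x"
      using inj_onD[OF inj, of m k] m kx by auto
    then show "?\<sigma> ((\<pi> ^^ m) y) = \<pi> ((\<pi> ^^ m) y)"
      using neq[of m] m by simp
  qed (use that in auto)
  have "(?\<sigma> ^^ k) x = x"
    using agree[of k] k0 kx by simp
  then have "orbit ?\<sigma> x = (\<lambda>m. (?\<sigma> ^^ m) x) ` {..<k}"
    using orbit_altdef_bounded[of k ?\<sigma> x] k0 by auto
  \<comment> \<open>The ranges differ at the ends: \<open>x\<close> is the start of the walk on the
    left but the point with index \<open>k\<close> on the right.\<close>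
  also have "\<dots> = (\<lambda>m. (\<pi> ^^ m) y) ` {1..k}" (is "?l = ?r")
  proof (intro equalityI subsetI)
    fix z assume "z \<in> ?l"
    then obtain m where m: "m < k" "z = (?\<sigma> ^^ m) x" by auto
    show "z \<in> ?r"
    proof (cases "m = 0")
      case True
      then show ?thesis
        using m kx k0 by (intro image_eqI[of _ _ k]) auto
    next
      case False
      then show ?thesis
        using m agree[of m] by (intro image_eqI[of _ _ m]) auto
    qed
  next
    fix z assume "z \<in> ?r"
    then obtain m where m: "1 \<le> m" "m \<le> k" "z = (\<pi> ^^ m) y" by auto
    show "z \<in> ?l"
    proof (cases "m = k")
      case True
      then show ?thesis
        using m kx k0 by (intro image_eqI[of _ _ 0]) auto
    next
      case False
      then show ?thesis
        using m agree[of m] by (intro image_eqI[of _ _ m]) auto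
    qed
  qed
  finally have orb: "orbit ?\<sigma> x = (\<lambda>m. (\<pi> ^^ m) y) ` {1..k}" .
  show "y \<notin> orbit ?\<sigma> x"
  proof
    assume "y \<in> orbit ?\<sigma> x"
    then obtain m where "0 < m" "m \<le> k" "(\<pi> ^^ m) y = y"
      unfolding orb by (auto simp: Suc_le_eq)
    then show False
      using neq by blast
  qed
  have "inj_on (\<lambda>m. (\<pi> ^^ m) y) {1..k}"
    by (rule inj_on_subset[OF inj]) auto
  then show "card (orbit ?\<sigma> x) = funpow_dist \<pi> y x"
    unfolding orb by (subst card_image) (auto simp: k_def)
qed

text \<open>Cutting is joining read backwards: after the cut, \<open>x\<close> and \<open>y\<close>
  lie in distinct cycles, and multiplying by the same transposition once more restores
  \<pi>.\<close>

lemma cycle_sets_comp_transpose_cut: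
  assumes p: "\<pi> permutes A" "finite A" and xy: "x \<in> A" "y \<in> A" "x \<noteq> y" "x \<in> orbit \<pi> y"
  shows "cycle_sets A \<pi> = merge_blocks x y (cycle_sets A (\<pi> \<circ> Transposition.transpose x y))"
    and "orbit \<pi> y = orbit (\<pi> \<circ> Transposition.transpose x y) x \<union> orbit (\<pi> \<circ> Transposition.transpose x y) y"
proof -
  note p' = permutes_comp_transpose[OF p(1) xy(1,2)] p(2)
  have eq: "\<pi> \<circ> Transposition.transpose x y \<circ> Transposition.transpose x y = \<pi>"
    by (simp add: comp_assoc)
  show "cycle_sets A \<pi> = merge_blocks x y (cycle_sets A (\<pi> \<circ> Transposition.transpose x y))"
    using cycle_sets_comp_transpose_join[OF p' xy(1,2) orbit_comp_transpose_cut(1)[OF p xy]] eq by simp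
  show "orbit \<pi> y = orbit (\<pi> \<circ> Transposition.transpose x y) x \<union> orbit (\<pi> \<circ> Transposition.transpose x y) y"
    using orbit_comp_transpose_join(2)[OF p' xy(1,2) orbit_comp_transpose_cut(1)[OF p xy]] eq by simp
qed

section \<open>A potential function\<close>

lemma refines_merge_blocks:
  assumes "partition_on A P" "x \<in> A" "y \<in> A"
  shows "refines A P (merge_blocks x y P)"
proof -
  have "\<exists>C\<in>merge_blocks x y P. B \<subseteq> C" if "B \<in> P" for B
  proof (cases "x \<in> B \<or> y \<in> B")
    case True
    then have "B \<subseteq> \<Union>{B\<in>P. x \<in> B \<or> y \<in> B}"
      using that by blast
    then show ?thesis
      unfolding merge_blocks_def by simp
  next
    case False
    then have "B \<in> merge_blocks x y P"
      using that unfolding merge_blocks_def by simp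
    then show ?thesis
      by blast
  qed
  then show ?thesis
    using assms partition_on_merge_blocks[OF assms] by (simp add: refines_def)
qed

lemma merge_blocks_mono:
  assumes "refines A P Q" "x \<in> A" "y \<in> A"
  shows "refines A (merge_blocks x y P) (merge_blocks x y Q)"
proof -
  have P: "partition_on A P" and Q: "partition_on A Q" and r: "\<And>B. B \<in> P \<Longrightarrow> \<exists>C\<in>Q. B \<subseteq> C"
    using assms(1) by (auto simp: refines_def)
  have "\<exists>C\<in>merge_blocks x y Q. B \<subseteq> C" if "B \<in> merge_blocks x y P" for B
  proof -
    from that consider "B = \<Union>{B\<in>P. x \<in> B \<or> y \<in> B}" | "B \<in> P" "x \<notin> B" "y \<notin> B"
      unfolding merge_blocks_def by blast
    then show ?thesis
    proof cases
      case 1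
      have "B \<subseteq> \<Union>{C\<in>Q. x \<in> C \<or> y \<in> C}"
        unfolding 1 using r by blast
      then show ?thesis
        by (auto simp: merge_blocks_def)
    next
      case 2
      then obtain C where C: "C \<in> Q" "B \<subseteq> C"
        using r by blast
      obtain D where "D \<in> merge_blocks x y Q" "C \<subseteq> D"
        using refines_merge_blocks[OF Q assms(2,3)] C(1) unfolding refines_def by blast
      then show ?thesis
        using C(2) by blast
    qed
  qed
  then show ?thesis
    using partition_on_merge_blocks[OF P assms(2,3)] partition_on_merge_blocks[OF Q assms(2,3)]
    by (simp add: refines_def)
qed

text \<open>The invariant behind the potential. A cut refines the cycles while the blocks only grow;
  a join merges cycles and blocks at the same two points, and merging is monotone under
  refinement.\<close>

lemma refines_cycle_sets_step:
  assumes p: "\<pi> permutes A" "finite A" and r: "refines A (cycle_sets A \<pi>) P"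
    and xy: "x \<in> A" "y \<in> A" "x \<noteq> y"
  shows "refines A (cycle_sets A (\<pi> \<circ> Transposition.transpose x y)) (merge_blocks x y P)"
proof (cases "x \<in> orbit \<pi> y")
  case True
  have "refines A (cycle_sets A (\<pi> \<circ> Transposition.transpose x y)) (cycle_sets A \<pi>)"
    unfolding cycle_sets_comp_transpose_cut(1)[OF p xy True]
    by (rule refines_merge_blocks
        [OF partition_on_cycle_sets[OF permutes_comp_transpose[OF p(1) xy(1,2)] p(2)] xy(1,2)])
  moreover have "refines A P (merge_blocks x y P)"
    using r xy by (intro refines_merge_blocks) (auto simp: refines_def)
  ultimately show ?thesis
    using r refines_trans by metis
next
  case False
  then have "y \<notin> orbit \<pi> x"
    using orbit_eq_if_in_orbit[OF p, of y x] self_in_orbit_permutes[OF p] by auto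
  then show ?thesis
    using cycle_sets_comp_transpose_join[OF p xy(1,2)] merge_blocks_mono[OF r xy(1,2)] by simp
qed

text \<open>A block contributes \<open>n\<^sup>2/d\<^sup>3\<close> and a cycle \<open>d\<^sup>2/a\<^sup>2\<close>. The weight \<open>1/a\<^sup>2\<close> makes the sum over all
  ways to cut a cycle bounded; the weight \<open>n\<^sup>2\<close> compensates the loss when cycles of distinct blocks
  are joined.\<close>

definition potential :: "'a set \<Rightarrow> ('a \<Rightarrow> 'a) \<Rightarrow> 'a set set \<Rightarrow> real" where
  "potential A \<pi> P = (\<Prod>B\<in>P. real (card B) ^ 2 / real (card A) ^ 3) *
     (\<Prod>c\<in>cycle_sets A \<pi>. real (card A) ^ 2 / real (card c) ^ 2)"

lemma potential_nonneg: "potential A \<pi> P \<ge> 0"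
  unfolding potential_def by (intro mult_nonneg_nonneg prod_nonneg) auto

lemma partition_on_card_pos:
  assumes "partition_on A P" "finite A" "B \<in> P"
  shows "0 < card B" "card B \<le> card A" "B \<subseteq> A"
proof -
  show "B \<subseteq> A"
    using partition_onD1[OF assms(1)] assms(3) by auto
  then show "card B \<le> card A"
    using assms(2) card_mono by blast
  show "0 < card B"
    using \<open>B \<subseteq> A\<close> assms(2,3) partition_onD3[OF assms(1)] by (metis card_gt_0_iff finite_subset)
qed

lemma orbit_in_cycle_sets: "x \<in> A \<Longrightarrow> orbit \<pi> x \<in> cycle_sets A \<pi>"
  by (simp add: cycle_sets_def)

text \<open>The weight d^2/(a+b)^2 replaces d^4/(a^2 b^2). An exact identity is required because
  cuts use it in the opposite direction.\<close>

lemma prod_cycle_weight_join: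
  fixes \<pi> :: "'a \<Rightarrow> 'a" and A :: "'a set"
  assumes p: "\<pi> permutes A" "finite A" and xy: "x \<in> A" "y \<in> A" "y \<notin> orbit \<pi> x"
  defines "a \<equiv> real (card (orbit \<pi> x))" and "b \<equiv> real (card (orbit \<pi> y))" and "d \<equiv> real (card A)"
  shows "(\<Prod>c\<in>cycle_sets A (\<pi> \<circ> Transposition.transpose x y). d ^ 2 / real (card c) ^ 2) =
    (\<Prod>c\<in>cycle_sets A \<pi>. d ^ 2 / real (card c) ^ 2) * ((a * b / (a + b)) ^ 2 / d ^ 2)"
proof -
  let ?w = "\<lambda>c. d ^ 2 / real (card c) ^ 2"
  note part = partition_on_cycle_sets[OF p]
  have in_orbit: "x \<in> orbit \<pi> x" "y \<in> orbit \<pi> y"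
    using self_in_orbit_permutes[OF p] by blast+
  have ne: "orbit \<pi> x \<noteq> orbit \<pi> y"
    using in_orbit xy(3) by auto
  have "orbit \<pi> x \<inter> orbit \<pi> y = {}"
    using disjointD[OF partition_onD2[OF part]] xy(1,2) ne by (simp add: cycle_sets_def)
  moreover have "finite (orbit \<pi> x)" "finite (orbit \<pi> y)"
    using in_orbit finite_orbit by metis+
  ultimately have ab: "real (card (orbit \<pi> x \<union> orbit \<pi> y)) = a + b"
    by (simp add: a_def b_def card_Un_disjoint)
  have pos: "a > 0" "b > 0" "d > 0"
    using partition_on_card_pos(1)[OF part p(2)] orbit_in_cycle_sets[of _ A \<pi>] xy p(2)
    by (auto simp: a_def b_def d_def card_gt_0_iff)
  have "prod ?w (cycle_sets A (\<pi> \<circ> Transposition.transpose x y)) * (d ^ 2 / a ^ 2 * (d ^ 2 / b ^ 2)) =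
      prod ?w (cycle_sets A \<pi>) * (d ^ 2 / (a + b) ^ 2)" (is "?U * _ = ?V * _")
    using prod_merge_blocks[OF part p(2) orbit_in_cycle_sets[OF xy(1)] in_orbit(1)
        orbit_in_cycle_sets[OF xy(2)] in_orbit(2) ne, of ?w]
    unfolding cycle_sets_comp_transpose_join[OF p xy] ab a_def[symmetric] b_def[symmetric] .
  then have "?U * (d ^ 2 / a ^ 2 * (d ^ 2 / b ^ 2)) * (a ^ 2 * b ^ 2 / (d ^ 2 * d ^ 2)) =
      ?V * (d ^ 2 / (a + b) ^ 2) * (a ^ 2 * b ^ 2 / (d ^ 2 * d ^ 2))"
    by simp
  moreover have "U * (d ^ 2 / a ^ 2 * (d ^ 2 / b ^ 2)) * (a ^ 2 * b ^ 2 / (d ^ 2 * d ^ 2)) = U" for U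
    using pos by simp
  moreover have "V * (d ^ 2 / (a + b) ^ 2) * (a ^ 2 * b ^ 2 / (d ^ 2 * d ^ 2)) =
      V * ((a * b / (a + b)) ^ 2 / d ^ 2)" for V
  proof -
    have "V * (t / s) * (q / (t * t)) = V * (q / s / t)" if "t \<noteq> 0" for q s t :: real
      using that by simp
    from this[of "d ^ 2"] show ?thesis
      using pos by (simp only: power_divide power_mult_distrib) simp
  qed
  ultimately show ?thesis
    by metis
qed

text \<open>Half the harmonic mean increases in both arguments. This lets the lengths of two cycles
  be replaced by the sizes of the blocks containing them.\<close>

lemma harmonic_pair_mono:
  fixes a b m n :: real
  assumes "0 < a" "a \<le> m" "0 < b" "b \<le> n"
  shows "a * b / (a + b) \<le> m * n / (m + n)"
proof -
  have "a * b * m \<le> a * n * m"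
    using assms by (intro mult_mono) auto
  moreover have "b * a * n \<le> b * m * n"
    using assms by (intro mult_mono) auto
  ultimately have "a * b * (m + n) \<le> m * n * (a + b)"
    by (simp add: algebra_simps)
  then show ?thesis
    using assms by (simp add: field_simps)
qed

text \<open>For cycles in one block, the blocks stay and the cycle weights change by a factor of at
  most 1, hence at most d. For distinct blocks of sizes m and n, the block weights contribute d^3
  ((m+n)/(mn))^2 and the cycle weights (ab/(a+b))^2/d^2; by monotonicity of ab/(a+b) the product is
  at most d.\<close>

lemma potential_join:
  fixes A :: "'a set"
  assumes p: "\<pi> permutes A" "finite A" and r: "refines A (cycle_sets A \<pi>) P"
    and xy: "x \<in> A" "y \<in> A" "y \<notin> orbit \<pi> x"
  shows "potential A (\<pi> \<circ> Transposition.transpose x y) (merge_blocks x y P) \<le> real (card A) * potential A \<pi> P"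
proof -
  define a b d where "a = real (card (orbit \<pi> x))" and "b = real (card (orbit \<pi> y))"
    and "d = real (card A)"
  let ?w = "\<lambda>B. real (card B) ^ 2 / d ^ 3"
  note part = partition_on_cycle_sets[OF p]
  have P: "partition_on A P"
    using r by (simp add: refines_def)
  have in_orbit: "x \<in> orbit \<pi> x" "y \<in> orbit \<pi> y"
    using self_in_orbit_permutes[OF p] by blast+
  obtain B where B: "B \<in> P" "orbit \<pi> x \<subseteq> B"
    using r orbit_in_cycle_sets[OF xy(1), of \<pi>] unfolding refines_def by blast
  obtain C where C: "C \<in> P" "orbit \<pi> y \<subseteq> C"
    using r orbit_in_cycle_sets[OF xy(2), of \<pi>] unfolding refines_def by blast
  have xB: "x \<in> B" and yC: "y \<in> C"
    using B C in_orbit by auto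
  define m n where "m = real (card B)" and "n = real (card C)"
  have fin: "finite B" "finite C"
    using partition_on_card_pos(3)[OF P p(2)] B(1) C(1) p(2) finite_subset by metis+
  have am: "a \<le> m" "b \<le> n"
    using card_mono[OF fin(1) B(2)] card_mono[OF fin(2) C(2)] by (auto simp: a_def b_def m_def n_def)
  have pos: "a > 0" "b > 0" "d > 0"
    using partition_on_card_pos(1)[OF part p(2)] orbit_in_cycle_sets[of _ A \<pi>] xy p(2)
    by (auto simp: a_def b_def d_def card_gt_0_iff)
  have nd: "n \<le> d"
    using partition_on_card_pos(2)[OF P p(2) C(1)] by (simp add: n_def d_def)
  let ?W = "\<Prod>c\<in>cycle_sets A \<pi>. d ^ 2 / real (card c) ^ 2"
  have W0: "0 \<le> ?W" and w0: "0 \<le> prod ?w P"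
    using pos by (auto intro!: prod_nonneg)
  have d1: "1 \<le> d"
    using pos(3) by (simp add: d_def)
  have pot: "potential A (\<pi> \<circ> Transposition.transpose x y) (merge_blocks x y P) =
      prod ?w (merge_blocks x y P) * (?W * ((a * b / (a + b)) ^ 2 / d ^ 2))"
    unfolding potential_def using prod_cycle_weight_join[OF p xy] by (simp add: a_def b_def d_def)
  have pot0: "potential A \<pi> P = prod ?w P * ?W"
    by (simp add: potential_def d_def)
  show ?thesis
  proof (cases "B = C")
    case True
    have "a * b / (a + b) \<le> d"
    proof -
      have "a * b / (a + b) \<le> b"
        using pos by (simp add: field_simps)
      then show ?thesis
        using am nd by simp
    qed
    then have "(a * b / (a + b)) ^ 2 / d ^ 2 \<le> 1"
      using pos by (simp add: power_mono)
    also have "1 \<le> d" by (rule d1)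
    finally have "prod ?w P * ?W * ((a * b / (a + b)) ^ 2 / d ^ 2) \<le> prod ?w P * ?W * d"
      using W0 w0 by (intro mult_left_mono) auto
    moreover have "merge_blocks x y P = P"
      using merge_blocks_same[OF P B(1) xB] yC True by simp
    ultimately show ?thesis
      unfolding pot pot0 d_def[symmetric] by (simp add: ac_simps)
  next
    case False
    have "B \<inter> C = {}"
      using disjointD[OF partition_onD2[OF P] B(1) C(1) False] .
    then have mn: "real (card (B \<union> C)) = m + n"
      using fin by (simp add: m_def n_def card_Un_disjoint)
    have pos': "m > 0" "n > 0"
      using pos am by auto
    have "prod ?w (merge_blocks x y P) * (m ^ 2 / d ^ 3 * (n ^ 2 / d ^ 3)) = prod ?w P * ((m + n) ^ 2 / d ^ 3)"
      (is "?U * _ = ?V * _")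
      using prod_merge_blocks[OF P p(2) B(1) xB C(1) yC False, of ?w]
      unfolding mn m_def[symmetric] n_def[symmetric] .
    then have "?U * (m ^ 2 / d ^ 3 * (n ^ 2 / d ^ 3)) * (d ^ 3 * d ^ 3 / (m + n) ^ 2) =
        ?V * ((m + n) ^ 2 / d ^ 3) * (d ^ 3 * d ^ 3 / (m + n) ^ 2)"
      by simp
    moreover have "U * (m ^ 2 / d ^ 3 * (n ^ 2 / d ^ 3)) * (d ^ 3 * d ^ 3 / (m + n) ^ 2) =
        U * (m * n / (m + n)) ^ 2" for U
      using pos by (simp add: power_divide power_mult_distrib)
    moreover have "V * ((m + n) ^ 2 / d ^ 3) * (d ^ 3 * d ^ 3 / (m + n) ^ 2) = V * d ^ 3" for V
    proof -
      have "V * (s / t) * (t * t / s) = V * t" if "s \<noteq> 0" "t \<noteq> 0" for s t :: real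
        using that by simp
      from this[of "(m + n) ^ 2" "d ^ 3"] show ?thesis
        using pos pos' by (simp del: power_add_numeral power_add_numeral2)
    qed
    ultimately have eq: "?U * (m * n / (m + n)) ^ 2 = ?V * d ^ 3"
      by metis
    have "(a * b / (a + b)) ^ 2 \<le> (m * n / (m + n)) ^ 2"
      using harmonic_pair_mono[OF pos(1) am(1) pos(2) am(2)] pos by (intro power_mono) auto
    then have "prod ?w (merge_blocks x y P) * (a * b / (a + b)) ^ 2
        \<le> prod ?w (merge_blocks x y P) * (m * n / (m + n)) ^ 2"
      using pos by (intro mult_left_mono prod_nonneg) auto
    then have "prod ?w (merge_blocks x y P) * (a * b / (a + b)) ^ 2 * (?W / d ^ 2) \<le> prod ?w P * d ^ 3 * (?W / d ^ 2)"
      unfolding eq using W0 by (intro mult_right_mono) auto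
    also have "\<dots> = d * (prod ?w P * ?W)"
      using pos by (simp add: power2_eq_square power3_eq_cube)
    finally show ?thesis
      unfolding pot pot0 d_def[symmetric] by (simp add: ac_simps)
  qed
qed

text \<open>The pieces have lengths k and L - k. Both points lie in one cycle and so in one block,
  hence only cycle weights change; their factor is the inverse of the join factor, since k(L-k)/L =
  1/(1/k + 1/(L-k)).\<close>

lemma potential_cut:
  fixes A :: "'a set"
  assumes p: "\<pi> permutes A" "finite A" and r: "refines A (cycle_sets A \<pi>) P"
    and xy: "x \<in> A" "y \<in> A" "x \<noteq> y" "x \<in> orbit \<pi> y"
  defines "k \<equiv> real (funpow_dist \<pi> y x)" and "L \<equiv> real (card (orbit \<pi> y))"
  shows "potential A (\<pi> \<circ> Transposition.transpose x y) (merge_blocks x y P) =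
      real (card A) ^ 2 * (1 / k + 1 / (L - k)) ^ 2 * potential A \<pi> P"
proof -
  define \<sigma> where "\<sigma> = \<pi> \<circ> Transposition.transpose x y"
  define d where "d = real (card A)"
  have P: "partition_on A P"
    using r by (simp add: refines_def)
  have p': "\<sigma> permutes A"
    unfolding \<sigma>_def by (rule permutes_comp_transpose[OF p(1) xy(1,2)])
  note part = partition_on_cycle_sets[OF p' p(2)]
  have in_orbit: "x \<in> orbit \<sigma> x" "y \<in> orbit \<sigma> y"
    using self_in_orbit_permutes[OF p' p(2)] by blast+
  have notin: "y \<notin> orbit \<sigma> x"
    unfolding \<sigma>_def by (rule orbit_comp_transpose_cut(1)[OF p xy])
  have undo: "\<sigma> \<circ> Transposition.transpose x y = \<pi>"
    by (simp add: \<sigma>_def comp_assoc)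
  have k: "real (card (orbit \<sigma> x)) = k"
    unfolding \<sigma>_def k_def by (simp add: orbit_comp_transpose_cut(2)[OF p xy])
  have un: "orbit \<pi> y = orbit \<sigma> x \<union> orbit \<sigma> y"
    unfolding \<sigma>_def by (rule cycle_sets_comp_transpose_cut(2)[OF p xy])
  have "orbit \<sigma> x \<inter> orbit \<sigma> y = {}"
    by (rule disjointD[OF partition_onD2[OF part]])
      (use xy in_orbit notin in \<open>auto simp: cycle_sets_def\<close>)
  then have "card (orbit \<pi> y) = card (orbit \<sigma> x) + card (orbit \<sigma> y)"
    unfolding un using in_orbit finite_orbit by (metis card_Un_disjoint)
  then have Lk: "real (card (orbit \<sigma> y)) = L - k"
    using k by (simp add: L_def)
  have "card (orbit \<sigma> x) > 0" "card (orbit \<sigma> y) > 0"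
    using partition_on_card_pos(1)[OF part p(2)] orbit_in_cycle_sets[of _ A \<sigma>] xy by blast+
  moreover have "card A > 0"
    using xy(1) p(2) card_gt_0_iff by blast
  ultimately have "k > 0" "real (card (orbit \<sigma> y)) > 0" "d > 0"
    by (simp_all add: d_def flip: k)
  then have pos: "k > 0" "L - k > 0" "d > 0"
    unfolding Lk .
  have W: "(\<Prod>c\<in>cycle_sets A \<pi>. d ^ 2 / real (card c) ^ 2) =
    (\<Prod>c\<in>cycle_sets A \<sigma>. d ^ 2 / real (card c) ^ 2) * ((k * (L - k) / L) ^ 2 / d ^ 2)"
    using prod_cycle_weight_join[OF p' p(2) xy(1,2) notin] unfolding undo k Lk by (simp add: d_def)
  have "merge_blocks x y P = P"
  proof -
    obtain B where B: "B \<in> P" "orbit \<pi> y \<subseteq> B"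
      using r orbit_in_cycle_sets[OF xy(2), of \<pi>] unfolding refines_def by blast
    then show ?thesis
      using merge_blocks_same[OF P B(1)] xy(4) un in_orbit by blast
  qed
  moreover have "(\<Prod>c\<in>cycle_sets A \<sigma>. d ^ 2 / real (card c) ^ 2) =
      d ^ 2 * (1 / k + 1 / (L - k)) ^ 2 * (\<Prod>c\<in>cycle_sets A \<pi>. d ^ 2 / real (card c) ^ 2)"
  proof -
    have "1 / k + 1 / (L - k) = 1 / (k * (L - k) / L)"
      using pos by (simp add: field_simps)
    moreover have "k * (L - k) / L \<noteq> 0"
      using pos by auto
    ultimately show ?thesis
      unfolding W using pos by (simp add: power_divide)
  qed
  ultimately show ?thesis
    unfolding potential_def \<sigma>_def[symmetric] d_def[symmetric] by simp
qed

text \<open>Telescoping: 1/(n+1)^2 \<le> 1/n - 1/(n+1). The induction carries the sharper bound 2 -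
  1/n.\<close>

lemma sum_inverse_squares_le: "(\<Sum>k=1..<n. 1 / real k ^ 2) \<le> 2"
proof -
  have bound: "(\<Sum>k=1..<Suc n. 1 / real k ^ 2) \<le> 2 - 1 / real n" if "n > 0" for n
    using that
  proof (induction n rule: nat_induct_non_zero)
    case (Suc n)
    have "1 / real (Suc n) ^ 2 \<le> 1 / real n - 1 / real (Suc n)"
    proof -
      have "1 / real (Suc n) ^ 2 \<le> 1 / (real n * real (Suc n))"
        using Suc.hyps by (intro divide_left_mono) (auto simp: power2_eq_square)
      also have "\<dots> = 1 / real n - 1 / real (Suc n)"
        using Suc.hyps by (simp add: field_simps)
      finally show ?thesis .
    qed
    then show ?case
      using Suc by simp
  qed simp
  have "(\<Sum>k=1..<Suc m. 1 / real k ^ 2) \<le> 2" if "m > 0" for m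
  proof -
    have "2 - 1 / real m \<le> 2"
      by simp
    then show ?thesis
      using bound[OF that] by linarith
  qed
  then have "(\<Sum>k=1..<Suc m. 1 / real k ^ 2) \<le> 2" for m
    by (cases "m = 0") auto
  from this[of "n - 1"] show ?thesis
    by (cases n) auto
qed

text \<open>By (u+v)^2 \<le> 2u^2 + 2v^2 and the reflection k to L - k, the sum is at most four
  times the sum of inverse squares. It is this bound, uniform in \<open>L\<close>, that the weight
  1/a^2 was chosen for.\<close>

lemma sum_cut_le: "(\<Sum>k=1..<L. (1 / real k + 1 / (real L - real k)) ^ 2) \<le> 8"
proof -
  have "(\<Sum>k=1..<L. (1 / real k + 1 / (real L - real k)) ^ 2)
      \<le> (\<Sum>k=1..<L. 2 * (1 / real k ^ 2) + 2 * (1 / real (L - k) ^ 2))"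
  proof (rule sum_mono)
    fix k assume "k \<in> {1..<L}"
    then have "real L - real k = real (L - k)"
      by auto
    moreover have "(u + v) ^ 2 \<le> 2 * u ^ 2 + 2 * v ^ 2" for u v :: real
      using zero_le_power2[of "u - v"] by (simp add: power2_eq_square algebra_simps)
    ultimately show "(1 / real k + 1 / (real L - real k)) ^ 2
        \<le> 2 * (1 / real k ^ 2) + 2 * (1 / real (L - k) ^ 2)"
      by (metis power_one_over)
  qed
  also have "\<dots> = 2 * (\<Sum>k=1..<L. 1 / real k ^ 2) + 2 * (\<Sum>k=1..<L. 1 / real (L - k) ^ 2)"
    by (simp add: sum.distrib sum_distrib_left)
  also have "(\<Sum>k=1..<L. 1 / real (L - k) ^ 2) = (\<Sum>k=1..<L. 1 / real k ^ 2)"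
    by (rule sum.reindex_bij_witness[of _ "\<lambda>k. L - k" "\<lambda>k. L - k"]) auto
  finally show ?thesis
    using sum_inverse_squares_le[of L] by simp
qed

text \<open>The constant 9 is 8 + 1. Points \<open>x\<close> in the cycle of \<open>y\<close> cut it
  and contribute at most 8 d^2 times the potential; each of the at most d other points joins two
  cycles and contributes at most d times the potential.\<close>

lemma sum_potential_step:
  fixes A :: "'a set"
  assumes p: "\<pi> permutes A" "finite A" and r: "refines A (cycle_sets A \<pi>) P" and y: "y \<in> A"
  shows "(\<Sum>x\<in>A - {y}. potential A (\<pi> \<circ> Transposition.transpose x y) (merge_blocks x y P))
    \<le> 9 * real (card A) ^ 2 * potential A \<pi> P"
proof -
  let ?f = "\<lambda>x. potential A (\<pi> \<circ> Transposition.transpose x y) (merge_blocks x y P)"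
  define d L where "d = real (card A)" and "L = card (orbit \<pi> y)"
  have yo: "y \<in> orbit \<pi> y"
    by (rule self_in_orbit_permutes[OF p])
  have sub: "orbit \<pi> y \<subseteq> A"
    by (rule permutes_orbit_subset[OF p(1) y])
  have fin: "finite (orbit \<pi> y)"
    using sub p(2) finite_subset by blast
  \<comment> \<open>Distinct points of the cycle lie at distinct distances from \<open>y\<close>, so
    the cuts can be summed over the length of one piece.\<close>
  have "(\<Sum>x\<in>orbit \<pi> y - {y}. (1 / real (funpow_dist \<pi> y x) + 1 / (real L - real (funpow_dist \<pi> y x))) ^ 2) =
      (\<Sum>k\<in>funpow_dist \<pi> y ` (orbit \<pi> y - {y}). (1 / real k + 1 / (real L - real k)) ^ 2)"
  proof -
    have "inj_on (funpow_dist \<pi> y) (orbit \<pi> y - {y})"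
    proof (rule inj_onI)
      fix u v assume "u \<in> orbit \<pi> y - {y}" "v \<in> orbit \<pi> y - {y}" "funpow_dist \<pi> y u = funpow_dist \<pi> y v"
      then show "u = v"
        by (metis DiffD1 funpow_dist_prop)
    qed
    then show ?thesis
      by (simp add: sum.reindex)
  qed
  also have "\<dots> \<le> (\<Sum>k=1..<L. (1 / real k + 1 / (real L - real k)) ^ 2)"
  proof (rule sum_mono2)
    show "funpow_dist \<pi> y ` (orbit \<pi> y - {y}) \<subseteq> {1..<L}"
    proof
      fix k assume "k \<in> funpow_dist \<pi> y ` (orbit \<pi> y - {y})"
      then obtain u where u: "u \<in> orbit \<pi> y" "u \<noteq> y" "k = funpow_dist \<pi> y u"
        by auto
      have "k \<noteq> 0"
        using funpow_dist_0_eq[OF u(1)] u(2,3) by auto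
      then show "k \<in> {1..<L}"
        using funpow_dist_less_card_orbit[OF yo u(1)] u(3) by (simp add: L_def)
    qed
  qed auto
  also have "\<dots> \<le> 8"
    by (rule sum_cut_le)
  finally have "(\<Sum>x\<in>orbit \<pi> y - {y}. (1 / real (funpow_dist \<pi> y x) +
      1 / (real L - real (funpow_dist \<pi> y x))) ^ 2) \<le> 8" (is "sum ?g _ \<le> _") .
  then have "sum ?g (orbit \<pi> y - {y}) * (d ^ 2 * potential A \<pi> P) \<le> 8 * (d ^ 2 * potential A \<pi> P)"
    using potential_nonneg[of A \<pi> P] by (intro mult_right_mono) auto
  moreover have "(\<Sum>x\<in>orbit \<pi> y - {y}. ?f x) = sum ?g (orbit \<pi> y - {y}) * (d ^ 2 * potential A \<pi> P)"
    unfolding sum_distrib_right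
    by (rule sum.cong) (use potential_cut[OF p r _ y] sub in \<open>auto simp: L_def d_def\<close>)
  ultimately have 1: "(\<Sum>x\<in>orbit \<pi> y - {y}. ?f x) \<le> 8 * (d ^ 2 * potential A \<pi> P)"
    by metis
  have "(\<Sum>x\<in>A - orbit \<pi> y. ?f x) \<le> (\<Sum>x\<in>A - orbit \<pi> y. d * potential A \<pi> P)"
  proof (rule sum_mono)
    fix x assume x: "x \<in> A - orbit \<pi> y"
    then have "y \<notin> orbit \<pi> x"
      using orbit_eq_if_in_orbit[OF p, of y x] self_in_orbit_permutes[OF p, of x] by auto
    then show "?f x \<le> d * potential A \<pi> P"
      using potential_join[OF p r _ y] x by (auto simp: d_def)
  qed
  also have "\<dots> = real (card (A - orbit \<pi> y)) * (d * potential A \<pi> P)"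
    by simp
  also have "\<dots> \<le> d * (d * potential A \<pi> P)"
    using potential_nonneg[of A \<pi> P] p(2) by (intro mult_right_mono) (auto simp: d_def card_mono)
  finally have 2: "(\<Sum>x\<in>A - orbit \<pi> y. ?f x) \<le> d ^ 2 * potential A \<pi> P"
    by (simp add: power2_eq_square)
  have "A - {y} = (orbit \<pi> y - {y}) \<union> (A - orbit \<pi> y)"
    using sub yo by auto
  moreover have "(orbit \<pi> y - {y}) \<inter> (A - orbit \<pi> y) = {}"
    by auto
  ultimately have "(\<Sum>x\<in>A - {y}. ?f x) = (\<Sum>x\<in>orbit \<pi> y - {y}. ?f x) + (\<Sum>x\<in>A - orbit \<pi> y. ?f x)"
    using fin p(2) by (simp add: sum.union_disjoint)
  then show ?thesis
    using 1 2 by (simp add: d_def)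
qed

section \<open>Permutations counted by cycles, and sequences of swaps\<close>

text \<open>The generating function of the unsigned Stirling numbers of the first kind. A new
  element \<open>a\<close> is either a fixed point, giving a factor x, or is inserted into an
  existing cycle, in as many ways as there are old elements and without changing the number of
  cycles.\<close>

lemma sum_permutations_power_card_cycles:
  fixes x :: real
  assumes "finite S"
  shows "(\<Sum>p | p permutes S. x ^ card (cycle_sets S p)) = pochhammer x (card S)"
  using assms
proof (induction S)
  case empty
  show ?case
    by (simp add: cycle_sets_def)
next
  case (insert a F)
  have fixed: "card (cycle_sets (insert a F) q) = Suc (card (cycle_sets F q))" if q: "q permutes F" for q
  proof -
    have "orbit q a = {a}"
      using permutes_not_in[OF q insert.hyps(2)] by (simp add: orbit_eq_singleton_iff)
    moreover have "{a} \<notin> cycle_sets F q"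
      using permutes_orbit_subset[OF q] insert.hyps(2) by (auto simp: cycle_sets_def)
    ultimately show ?thesis
      using insert.hyps(1) by (simp add: cycle_sets_def)
  qed
  have joined: "card (cycle_sets (insert a F) (Transposition.transpose a b \<circ> q)) = card (cycle_sets F q)"
    if q: "q permutes F" and b: "b \<in> F" for q b
  proof -
    define c where "c = Hilbert_Choice.inv q b"
    have q': "q permutes insert a F"
      by (rule permutes_subset[OF q]) auto
    have c: "c \<in> F"
      unfolding c_def using permutes_inv[OF q] b by (simp add: permutes_in_image)
    have "Hilbert_Choice.inv q a = a"
      using permutes_not_in[OF permutes_inv[OF q] insert.hyps(2)] .
    \<comment> \<open>Conjugation by \<open>q\<close> moves the transposition from the left to the
      right, where the join lemma applies.\<close>
    then have eq: "Transposition.transpose a b \<circ> q = q \<circ> Transposition.transpose a c"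
      using transpose_comp_eq[OF permutes_bij[OF q], of a b] by (simp add: c_def)
    have "orbit q a = {a}"
      using permutes_not_in[OF q insert.hyps(2)] by (simp add: orbit_eq_singleton_iff)
    then have notin: "c \<notin> orbit q a" and ne: "orbit q a \<noteq> orbit q c"
      using c insert.hyps(2) permutes_orbit_subset[OF q c] by auto
    have fin: "finite (insert a F)"
      using insert.hyps(1) by simp
    have "Suc (card (merge_blocks a c (cycle_sets (insert a F) q))) = card (cycle_sets (insert a F) q)"
      using c self_in_orbit_permutes[OF q' fin]
      by (intro card_merge_blocks[OF partition_on_cycle_sets[OF q' fin] fin _ _ _ _ ne])
        (auto simp: cycle_sets_def)
    then show ?thesis
      using cycle_sets_comp_transpose_join[OF q' fin _ _ notin] c fixed[OF q] eq by simp
  qed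
  let ?S = "\<Sum>p | p permutes F. x ^ card (cycle_sets F p)"
  have "(\<Sum>p | p permutes insert a F. x ^ card (cycle_sets (insert a F) p)) =
    (\<Sum>b\<in>insert a F. \<Sum>q | q permutes F.
      x ^ card (cycle_sets (insert a F) (Transposition.transpose a b \<circ> q)))"
    by (rule sum_over_permutations_insert[OF insert.hyps])
  also have "\<dots> = (\<Sum>q | q permutes F. x ^ card (cycle_sets (insert a F) q)) +
      (\<Sum>b\<in>F. \<Sum>q | q permutes F. x ^ card (cycle_sets (insert a F) (Transposition.transpose a b \<circ> q)))"
    using insert.hyps by simp
  also have "(\<Sum>q | q permutes F. x ^ card (cycle_sets (insert a F) q)) = x * ?S"
    unfolding sum_distrib_left by (rule sum.cong) (auto simp: fixed)
  also have "(\<Sum>b\<in>F. \<Sum>q | q permutes F. x ^ card (cycle_sets (insert a F) (Transposition.transpose a b \<circ> q))) =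
      (\<Sum>b\<in>F. ?S)"
    by (intro sum.cong) (auto simp: joined)
  also have "x * ?S + (\<Sum>b\<in>F. ?S) = ?S * (x + real (card F))"
    by (simp add: algebra_simps)
  finally show ?case
    using insert by (simp add: pochhammer_Suc)
qed

text \<open>The rising factorial d (d+1) ... (2d-1) is d! times the binomial coefficient of 2d-1
  over d.\<close>

lemma pochhammer_self_le:
  "pochhammer (real d) d \<le> 4 ^ d * fact d"
proof (cases "d = 0")
  case False
  have "pochhammer (real d) d / fact d = real (2 * d - 1) gchoose d"
    using False by (simp add: gbinomial_pochhammer' of_nat_diff)
  also have "\<dots> = real ((2 * d - 1) choose d)"
    by (simp add: binomial_gbinomial)
  also have "\<dots> \<le> 2 ^ (2 * d - 1)"
    using binomial_le_pow2[of "2 * d - 1" d] by (metis of_nat_le_iff of_nat_numeral of_nat_power)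
  also have "\<dots> \<le> (2::real) ^ (2 * d)"
    by (rule power_increasing) auto
  also have "\<dots> = 4 ^ d"
    by (simp add: power_mult)
  finally show ?thesis
    by (simp add: field_simps)
qed simp

section \<open>Sequences of swaps and the partition they generate\<close>

definition apply_swaps :: "('a \<Rightarrow> 'a) \<Rightarrow> ('a \<times> 'a) list \<Rightarrow> 'a \<Rightarrow> 'a" where
  "apply_swaps \<pi> ps = foldl (\<lambda>\<sigma> (x, y). \<sigma> \<circ> Transposition.transpose x y) \<pi> ps"

definition merge_all :: "('a \<times> 'a) list \<Rightarrow> 'a set set \<Rightarrow> 'a set set" where
  "merge_all ps P = foldl (\<lambda>Q (x, y). merge_blocks x y Q) P ps"

lemma apply_swaps_simps [simp]:
  "apply_swaps \<pi> [] = \<pi>"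
  "apply_swaps \<pi> ((x, y) # ps) = apply_swaps (\<pi> \<circ> Transposition.transpose x y) ps"
  by (simp_all add: apply_swaps_def)

lemma merge_all_simps [simp]:
  "merge_all [] P = P"
  "merge_all ((x, y) # ps) P = merge_all ps (merge_blocks x y P)"
  by (simp_all add: merge_all_def)

lemma apply_swaps_conv_foldl:
  "apply_swaps \<pi> ps = foldl (\<circ>) \<pi> (map (\<lambda>(x, y). Transposition.transpose x y) ps)"
  unfolding apply_swaps_def by (induction ps arbitrary: \<pi>) auto

lemma apply_swaps_permutes:
  assumes "\<pi> permutes A" "set ps \<subseteq> A \<times> A"
  shows "apply_swaps \<pi> ps permutes A"
  using assms
proof (induction ps arbitrary: \<pi>)
  case (Cons p ps)
  then show ?case
    by (cases p) (auto intro!: Cons.IH permutes_comp_transpose)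
qed simp

lemma refines_merge_all:
  assumes "partition_on A P" "set ps \<subseteq> A \<times> A"
  shows "refines A P (merge_all ps P)"
  using assms
proof (induction ps arbitrary: P)
  case Nil
  then show ?case by (simp add: refines_refl)
next
  case (Cons p ps)
  obtain x y where p: "p = (x, y)"
    by (cases p)
  have "refines A P (merge_blocks x y P)"
    using Cons.prems p by (intro refines_merge_blocks) auto
  moreover have "refines A (merge_blocks x y P) (merge_all ps (merge_blocks x y P))"
    using Cons.prems p by (intro Cons.IH partition_on_merge_blocks) auto
  ultimately show ?case
    using p refines_trans by auto
qed

text \<open>The two points come together when their pair is processed, and later merges only coarsen
  the partition.\<close>

lemma merge_all_joins:
  assumes "partition_on A P" "set ps \<subseteq> A \<times> A" "(x, y) \<in> set ps"
  shows "\<exists>B\<in>merge_all ps P. x \<in> B \<and> y \<in> B"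
  using assms
proof (induction ps arbitrary: P)
  case (Cons p ps)
  obtain u v where p: "p = (u, v)"
    by (cases p)
  have uv: "u \<in> A" "v \<in> A"
    using Cons.prems p by auto
  have part: "partition_on A (merge_blocks u v P)"
    by (rule partition_on_merge_blocks[OF Cons.prems(1) uv])
  show ?case
  proof (cases "(x, y) \<in> set ps")
    case True
    then show ?thesis
      using Cons.IH[OF part] Cons.prems p by auto
  next
    case False
    then have xy: "x = u" "y = v"
      using Cons.prems(3) p by auto
    let ?B = "\<Union>{B\<in>P. u \<in> B \<or> v \<in> B}"
    have "u \<in> ?B" "v \<in> ?B"
      using partition_onD1[OF Cons.prems(1)] uv by auto
    moreover have "?B \<in> merge_blocks u v P"
      by (simp add: merge_blocks_def)
    moreover have "refines A (merge_blocks u v P) (merge_all ps (merge_blocks u v P))"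
      using refines_merge_all[OF part] Cons.prems by auto
    ultimately obtain C where "C \<in> merge_all ps (merge_blocks u v P)" "?B \<subseteq> C"
      unfolding refines_def by blast
    then show ?thesis
      using \<open>u \<in> ?B\<close> \<open>v \<in> ?B\<close> unfolding xy p merge_all_simps by blast
  qed
qed simp

text \<open>The case of inverses uses finiteness: an injective map of a finite set into itself is
  onto, so its inverse preserves the set too.\<close>

lemma generate_sym_group_stable:
  assumes S: "S \<subseteq> {p. p permutes {1..d}}" and "\<sigma> \<in> generate (sym_group d) S"
    and B: "finite B" "\<And>s. s \<in> S \<Longrightarrow> s ` B \<subseteq> B"
  shows "\<sigma> ` B \<subseteq> B"
  using assms(2)
proof induction
  case one
  then show ?case by (simp add: sym_group_one)
next
  case (incl h)
  then show ?case by (rule B(2))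
next
  case (inv h)
  have h: "h permutes {1..d}"
    using inv S by auto
  have "h ` B = B"
    using endo_inj_surj[OF B(1) B(2)[OF inv]] permutes_inj_on[OF h] by simp
  then have "Hilbert_Choice.inv h ` B = B"
    using permutes_inj[OF h] by (metis image_inv_f_f)
  then show ?case
    using h by (simp add: sym_group_carrier)
next
  case (eng h1 h2)
  then show ?case
    unfolding sym_group_mult image_comp[symmetric] by blast
qed

text \<open>The block of 1 is preserved by \<open>\<rho>\<close>, whose cycles lie inside blocks,
  and by each transposition, whose two points share a block. Hence the generated group preserves it,
  and transitivity makes it everything.\<close>

lemma merge_all_transitive:
  assumes "\<rho> permutes {1..d}" "d > 0" "set ps \<subseteq> {1..d} \<times> {1..d}"
    and trans: "generates_transitive d (insert \<rho> (set (map (\<lambda>(x, y). Transposition.transpose x y) ps)))"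
  shows "merge_all ps (cycle_sets {1..d} \<rho>) = {{1..d}}"
proof -
  define Q where "Q = merge_all ps (cycle_sets {1..d} \<rho>)"
  let ?S = "insert \<rho> (set (map (\<lambda>(x, y). Transposition.transpose x y) ps))"
  have part: "partition_on {1..d} (cycle_sets {1..d} \<rho>)"
    by (rule partition_on_cycle_sets[OF assms(1)]) simp
  have r: "refines {1..d} (cycle_sets {1..d} \<rho>) Q"
    unfolding Q_def by (rule refines_merge_all[OF part assms(3)])
  have Q: "partition_on {1..d} Q"
    using r by (simp add: refines_def)
  obtain B where B: "B \<in> Q" "1 \<in> B"
    using partition_on_obtain_block[OF Q, of 1] \<open>d > 0\<close> by auto
  have sub: "B \<subseteq> {1..d}" "finite B"
    using partition_on_card_pos(3)[OF Q _ B(1)] finite_subset by auto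
  have stable: "s ` B \<subseteq> B" if "s \<in> ?S" for s
  proof -
    from that consider "s = \<rho>" | x y where "(x, y) \<in> set ps" "s = Transposition.transpose x y"
      by auto
    then show ?thesis
    proof cases
      case 1
      show ?thesis
      proof
        fix w assume "w \<in> s ` B"
        then obtain z where z: "z \<in> B" "w = \<rho> z"
          using 1 by auto
        obtain C where C: "C \<in> Q" "orbit \<rho> z \<subseteq> C"
          using r orbit_in_cycle_sets[of z "{1..d}" \<rho>] z(1) sub unfolding refines_def by blast
        have "z \<in> C"
          using C(2) self_in_orbit_permutes[OF assms(1)] by auto
        then have "C = B"
          using partition_on_block_unique[OF Q C(1) B(1)] z(1) by blast
        then show "w \<in> B"
          using C(2) z(2) orbit.base[of \<rho> z] by auto
      qed
    next
      case 2
      obtain C where C: "C \<in> Q" "x \<in> C" "y \<in> C"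
        using merge_all_joins[OF part assms(3) 2(1)] by (auto simp: Q_def)
      then have "x \<in> B \<longleftrightarrow> y \<in> B"
        using partition_on_block_unique[OF Q C(1) B(1)] by blast
      then show ?thesis
        unfolding 2(2) by (auto simp: Transposition.transpose_def)
    qed
  qed
  have S: "?S \<subseteq> {p. p permutes {1..d}}"
    using assms(1,3) by (auto intro: permutes_swap_id)
  have "{1..d} \<subseteq> B"
  proof
    fix y assume "y \<in> {1..d}"
    then obtain \<sigma> where "\<sigma> \<in> generate (sym_group d) ?S" "\<sigma> 1 = y"
      using trans \<open>d > 0\<close> unfolding generates_transitive_def by force
    then show "y \<in> B"
      using generate_sym_group_stable[OF S _ sub(2) stable] B(2) by blast
  qed
  then have "B = {1..d}"
    using sub by auto
  moreover have "C = B" if "C \<in> Q" for C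
  proof -
    from that obtain z where "z \<in> C"
      using partition_onD3[OF Q] by (metis ex_in_conv)
    moreover have "C \<subseteq> {1..d}"
      using partition_onD1[OF Q] that by auto
    ultimately show ?thesis
      using partition_on_block_unique[OF Q that B(1), of z] \<open>B = {1..d}\<close> by auto
  qed
  ultimately show ?thesis
    using B(1) unfolding Q_def by blast
qed

text \<open>The initial value: when the blocks are the cycles themselves, the squared sizes cancel
  and each cycle leaves 1/d.\<close>

lemma potential_cycle_sets:
  assumes "\<pi> permutes A" "finite A"
  shows "potential A \<pi> (cycle_sets A \<pi>) = (1 / real (card A)) ^ card (cycle_sets A \<pi>)"
proof -
  have "potential A \<pi> (cycle_sets A \<pi>) =
    (\<Prod>c\<in>cycle_sets A \<pi>. (real (card c) ^ 2 / real (card A) ^ 3) * (real (card A) ^ 2 / real (card c) ^ 2))"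
    unfolding potential_def prod.distrib ..
  also have "\<dots> = (\<Prod>c\<in>cycle_sets A \<pi>. 1 / real (card A))"
  proof (rule prod.cong)
    fix c assume c: "c \<in> cycle_sets A \<pi>"
    have "card c > 0" "card A > 0"
      using partition_on_card_pos(1,2)[OF partition_on_cycle_sets[OF assms] assms(2) c] by auto
    then show "(real (card c) ^ 2 / real (card A) ^ 3) * (real (card A) ^ 2 / real (card c) ^ 2) =
        1 / real (card A)"
      by (simp add: power2_eq_square power3_eq_cube)
  qed simp
  finally show ?thesis
    by simp
qed

text \<open>The final value: the single block gives 1/d. As c \<le> 2^c and the cycle lengths add up
  to d, the product of their squares is at most 4^d.\<close>

lemma potential_single_block_ge:
  assumes "\<pi> permutes A" "finite A" "A \<noteq> {}"
  shows "real (card A) ^ (2 * card (cycle_sets A \<pi>)) / (real (card A) * 4 ^ card A) \<le> potential A \<pi> {A}"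
proof -
  define d where "d = real (card A)"
  have d: "d > 0"
    using assms by (simp add: d_def card_gt_0_iff)
  note part = partition_on_cycle_sets[OF assms(1,2)]
  let ?m = "card (cycle_sets A \<pi>)"
  have pos: "card c > 0" if "c \<in> cycle_sets A \<pi>" for c
    using partition_on_card_pos(1)[OF part assms(2) that] .
  have "(\<Prod>c\<in>cycle_sets A \<pi>. real (card c) ^ 2) \<le> (\<Prod>c\<in>cycle_sets A \<pi>. 4 ^ card c)"
  proof (rule prod_mono)
    fix c
    have "real (card c) \<le> 2 ^ card c"
      by (metis less_exp less_imp_le of_nat_le_iff of_nat_numeral of_nat_power)
    then have "real (card c) ^ 2 \<le> (2 ^ card c) ^ 2"
      by (intro power_mono) auto
    also have "\<dots> = 4 ^ card c"
      by (simp add: power2_eq_square flip: power_mult_distrib)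
    finally show "0 \<le> real (card c) ^ 2 \<and> real (card c) ^ 2 \<le> 4 ^ card c"
      by simp
  qed
  also have "\<dots> = 4 ^ (\<Sum>c\<in>cycle_sets A \<pi>. card c)"
    by (rule power_sum[symmetric])
  also have "(\<Sum>c\<in>cycle_sets A \<pi>. card c) = card A"
  proof -
    have "card (\<Union>(cycle_sets A \<pi>)) = sum card (cycle_sets A \<pi>)"
      using partition_onD2[OF part] finite_subset[OF partition_on_card_pos(3)[OF part assms(2)] assms(2)]
      by (intro card_Union_disjoint) (auto simp: disjoint_def pairwise_def disjnt_def)
    then show ?thesis
      using partition_onD1[OF part] by simp
  qed
  finally have le: "(\<Prod>c\<in>cycle_sets A \<pi>. real (card c) ^ 2) \<le> 4 ^ card A" .
  have pos': "(\<Prod>c\<in>cycle_sets A \<pi>. real (card c) ^ 2) > 0"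
    using pos by (intro prod_pos) auto
  have "potential A \<pi> {A} = d ^ 2 / d ^ 3 * ((d ^ 2) ^ ?m / (\<Prod>c\<in>cycle_sets A \<pi>. real (card c) ^ 2))"
    by (simp add: potential_def prod_dividef d_def)
  also have "\<dots> = 1 / d * (d ^ (2 * ?m) / (\<Prod>c\<in>cycle_sets A \<pi>. real (card c) ^ 2))"
    using d by (simp add: power_mult power2_eq_square power3_eq_cube)
  also have "\<dots> \<ge> 1 / d * (d ^ (2 * ?m) / 4 ^ card A)"
    using le pos' d by (intro mult_left_mono divide_left_mono) auto
  finally show ?thesis
    by (simp add: d_def)
qed

section \<open>Counting monotone factorizations\<close>

text \<open>The lower bound \<open>j\<close> on the larger entries makes the set recursive in its
  first pair: the larger entry of that pair is the bound for the rest.\<close>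

definition monotone_pairs :: "nat \<Rightarrow> nat \<Rightarrow> nat \<Rightarrow> (nat \<times> nat) list set" where
  "monotone_pairs d j r =
     {ps. length ps = r \<and> (\<forall>(x, y)\<in>set ps. 1 \<le> x \<and> x < y \<and> y \<le> d \<and> j \<le> y) \<and> sorted (map snd ps)}"

lemma monotone_pairs_0: "monotone_pairs d j 0 = {[]}"
  by (auto simp: monotone_pairs_def)

lemma monotone_pairs_Suc:
  "monotone_pairs d j (Suc r) =
     (\<Union>y\<in>{j..d}. \<Union>x\<in>{1..<y}. (\<lambda>ps. (x, y) # ps) ` monotone_pairs d y r)"
proof (intro equalityI subsetI)
  fix qs assume qs: "qs \<in> monotone_pairs d j (Suc r)"
  then obtain x y ps where "qs = (x, y) # ps"
    unfolding monotone_pairs_def by (cases qs) auto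
  then show "qs \<in> (\<Union>y\<in>{j..d}. \<Union>x\<in>{1..<y}. (\<lambda>ps. (x, y) # ps) ` monotone_pairs d y r)"
    using qs by (fastforce simp: monotone_pairs_def)
next
  fix qs assume "qs \<in> (\<Union>y\<in>{j..d}. \<Union>x\<in>{1..<y}. (\<lambda>ps. (x, y) # ps) ` monotone_pairs d y r)"
  then obtain x y ps where "y \<in> {j..d}" "x \<in> {1..<y}" "ps \<in> monotone_pairs d y r" "qs = (x, y) # ps"
    by blast
  then show "qs \<in> monotone_pairs d j (Suc r)"
    by (fastforce simp: monotone_pairs_def)
qed

lemma finite_monotone_pairs: "finite (monotone_pairs d j r)"
  by (induction r arbitrary: j) (simp_all add: monotone_pairs_0 monotone_pairs_Suc)

lemma sum_monotone_pairs_Suc: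
  fixes f :: "(nat \<times> nat) list \<Rightarrow> real"
  shows "sum f (monotone_pairs d j (Suc r)) =
    (\<Sum>y=j..d. \<Sum>x=1..<y. \<Sum>ps\<in>monotone_pairs d y r. f ((x, y) # ps))"
proof -
  have "sum f (monotone_pairs d j (Suc r)) =
      (\<Sum>y=j..d. sum f (\<Union>x\<in>{1..<y}. (\<lambda>ps. (x, y) # ps) ` monotone_pairs d y r))"
    unfolding monotone_pairs_Suc
    by (rule sum.UNION_disjoint) (auto simp: finite_monotone_pairs)
  also have "\<dots> = (\<Sum>y=j..d. \<Sum>x=1..<y. sum f ((\<lambda>ps. (x, y) # ps) ` monotone_pairs d y r))"
    by (intro sum.cong refl sum.UNION_disjoint) (auto simp: finite_monotone_pairs)
  also have "\<dots> = (\<Sum>y=j..d. \<Sum>x=1..<y. \<Sum>ps\<in>monotone_pairs d y r. f ((x, y) # ps))"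
  proof -
    have "sum f ((\<lambda>ps. (x, y) # ps) ` monotone_pairs d y r) =
        (\<Sum>ps\<in>monotone_pairs d y r. f ((x, y) # ps))" for x y
      by (subst sum.reindex) (auto simp: inj_on_def)
    then show ?thesis
      by simp
  qed
  finally show ?thesis .
qed

lemma sum_power_two_le:
  assumes "j \<le> d"
  shows "(\<Sum>y=j..d. (2::real) ^ (d - y)) \<le> 2 ^ Suc (d - j)"
proof -
  have "(\<Sum>y=j..d. (2::real) ^ (d - y)) = (\<Sum>i<Suc (d - j). 2 ^ i)"
    by (rule sum.reindex_bij_witness[of _ "\<lambda>i. d - i" "\<lambda>y. d - y"]) (use assms in auto)
  moreover have "(\<Sum>i<n. (2::real) ^ i) \<le> 2 ^ n" for n
    by (induction n) auto
  ultimately show ?thesis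
    by metis
qed

text \<open>Induction on the length, splitting off the first pair. Summing over the smaller entry
  costs 9 d^2. For the larger entry, the factor 2^(d-y) in the bound is summable: over all y \<ge> j
  it gives at most 2 * 2^(d-j), so a step costs a factor 2 instead of d.\<close>

lemma sum_potential_monotone_pairs:
  assumes "\<pi> permutes {1..d}" "refines {1..d} (cycle_sets {1..d} \<pi>) P" "1 \<le> j" "j \<le> d"
  shows "(\<Sum>ps\<in>monotone_pairs d j r. potential {1..d} (apply_swaps \<pi> ps) (merge_all ps P))
    \<le> (9 * real d ^ 2) ^ r * 2 ^ (r + (d - j)) * potential {1..d} \<pi> P"
  using assms
proof (induction r arbitrary: \<pi> P j)
  case 0
  have "1 * potential {1..d} \<pi> P \<le> 2 ^ (d - j) * potential {1..d} \<pi> P"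
    using potential_nonneg by (intro mult_right_mono) auto
  then show ?case
    by (simp add: monotone_pairs_0)
next
  case (Suc r)
  let ?A = "{1..d}"
  let ?C = "(9 * real d ^ 2) ^ r"
  let ?\<pi> = "\<lambda>x y. \<pi> \<circ> Transposition.transpose x y" and ?P = "\<lambda>x y. merge_blocks x y P"
  have "(\<Sum>ps\<in>monotone_pairs d j (Suc r). potential ?A (apply_swaps \<pi> ps) (merge_all ps P)) =
      (\<Sum>y=j..d. \<Sum>x=1..<y. \<Sum>ps\<in>monotone_pairs d y r.
        potential ?A (apply_swaps (?\<pi> x y) ps) (merge_all ps (?P x y)))"
    unfolding sum_monotone_pairs_Suc by simp
  also have "\<dots> \<le> (\<Sum>y=j..d. \<Sum>x=1..<y. ?C * 2 ^ (r + (d - y)) * potential ?A (?\<pi> x y) (?P x y))"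
  proof (intro sum_mono)
    fix y x assume "y \<in> {j..d}" "x \<in> {1..<y}"
    then have xy: "x \<in> ?A" "y \<in> ?A" "x \<noteq> y"
      using Suc.prems(3) by auto
    show "(\<Sum>ps\<in>monotone_pairs d y r. potential ?A (apply_swaps (?\<pi> x y) ps) (merge_all ps (?P x y)))
        \<le> ?C * 2 ^ (r + (d - y)) * potential ?A (?\<pi> x y) (?P x y)"
      using xy Suc.prems(1,2)
      by (intro Suc.IH permutes_comp_transpose refines_cycle_sets_step) auto
  qed
  also have "\<dots> = (\<Sum>y=j..d. ?C * 2 ^ (r + (d - y)) * (\<Sum>x=1..<y. potential ?A (?\<pi> x y) (?P x y)))"
    by (simp add: sum_distrib_left)
  also have "\<dots> \<le> (\<Sum>y=j..d. ?C * 2 ^ (r + (d - y)) * (9 * real d ^ 2 * potential ?A \<pi> P))"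
  proof (intro sum_mono mult_left_mono)
    fix y assume y: "y \<in> {j..d}"
    \<comment> \<open>Terms are nonnegative, so the sum over x < y may be enlarged to all x distinct
      from \<open>y\<close>, as in the one-step estimate.\<close>
    have "(\<Sum>x=1..<y. potential ?A (?\<pi> x y) (?P x y)) \<le> (\<Sum>x\<in>?A - {y}. potential ?A (?\<pi> x y) (?P x y))"
      using y by (intro sum_mono2 potential_nonneg) auto
    also have "\<dots> \<le> 9 * real (card ?A) ^ 2 * potential ?A \<pi> P"
      using y Suc.prems by (intro sum_potential_step) auto
    finally show "(\<Sum>x=1..<y. potential ?A (?\<pi> x y) (?P x y)) \<le> 9 * real d ^ 2 * potential ?A \<pi> P"
      by simp
  qed auto
  also have "\<dots> = (?C * (9 * real d ^ 2) * 2 ^ r * potential ?A \<pi> P) * (\<Sum>y=j..d. 2 ^ (d - y))"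
    unfolding sum_distrib_left power_add by (simp only: ac_simps)
  also have "\<dots> \<le> (?C * (9 * real d ^ 2) * 2 ^ r * potential ?A \<pi> P) * 2 ^ Suc (d - j)"
    using sum_power_two_le[OF Suc.prems(4)]
    by (intro mult_left_mono mult_nonneg_nonneg potential_nonneg) auto
  finally show ?case
    by (simp add: power_add ac_simps)
qed

text \<open>Only the number \<open>m\<close> of cycles of the product is prescribed, so all \<beta>
  of the same length are counted together. Transitivity enters through the merged partition.\<close>

definition transitive_pairs :: "nat \<Rightarrow> nat \<Rightarrow> nat \<Rightarrow> (nat \<Rightarrow> nat) \<Rightarrow> (nat \<times> nat) list set" where
  "transitive_pairs d r m \<rho> = {ps \<in> monotone_pairs d 1 r.
     card (cycle_sets {1..d} (apply_swaps \<rho> ps)) = m \<and> merge_all ps (cycle_sets {1..d} \<rho>) = {{1..d}}}"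

lemma monotone_pairs_subset:
  assumes "ps \<in> monotone_pairs d j r"
  shows "set ps \<subseteq> {1..d} \<times> {1..d}"
proof
  fix p assume p: "p \<in> set ps"
  obtain x y where xy: "p = (x, y)"
    by (cases p)
  have "1 \<le> x \<and> x < y \<and> y \<le> d"
    using assms p unfolding monotone_pairs_def xy by auto
  then show "p \<in> {1..d} \<times> {1..d}"
    unfolding xy by simp
qed

text \<open>Each counted list ends with potential at least d^(2m-1)/4^d, while all lists together
  have at most (9 d^2)^r 2^(r+d) d^(-l), where l is the number of cycles of \<open>\<rho>\<close>.
  Division bounds the count by 18^r 8^d d^(2r+1-l-2m).\<close>

lemma card_transitive_pairs_le:
  assumes \<rho>: "\<rho> permutes {1..d}" and "d > 0"
    and r: "r + 2 = 2 * g + card (cycle_sets {1..d} \<rho>) + m"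
  shows "real (card (transitive_pairs d r m \<rho>)) \<le>
    18 ^ r * 8 ^ d * real d ^ (4 * g) * real d ^ card (cycle_sets {1..d} \<rho>)"
proof -
  let ?A = "{1..d}" and ?l = "card (cycle_sets {1..d} \<rho>)" and ?T = "transitive_pairs d r m \<rho>"
  let ?P = "cycle_sets {1..d} \<rho>"
  let ?D = "real d"
  have D: "?D \<ge> 1"
    using \<open>d > 0\<close> by simp
  have "real (card ?T) * (?D ^ (2 * m) / (?D * 4 ^ d)) =
      (\<Sum>ps\<in>?T. ?D ^ (2 * m) / (?D * 4 ^ d))"
    by simp
  also have "\<dots> \<le> (\<Sum>ps\<in>?T. potential ?A (apply_swaps \<rho> ps) (merge_all ps ?P))"
  proof (rule sum_mono)
    fix ps assume "ps \<in> ?T"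
    then have ps: "ps \<in> monotone_pairs d 1 r" "card (cycle_sets ?A (apply_swaps \<rho> ps)) = m"
      "merge_all ps ?P = {?A}"
      by (auto simp: transitive_pairs_def)
    show "?D ^ (2 * m) / (?D * 4 ^ d) \<le> potential ?A (apply_swaps \<rho> ps) (merge_all ps ?P)"
      using potential_single_block_ge[OF apply_swaps_permutes[OF \<rho> monotone_pairs_subset[OF ps(1)]]]
        ps(2,3) \<open>d > 0\<close> by simp
  qed
  also have "\<dots> \<le> (\<Sum>ps\<in>monotone_pairs d 1 r. potential ?A (apply_swaps \<rho> ps) (merge_all ps ?P))"
    by (intro sum_mono2 finite_monotone_pairs potential_nonneg) (auto simp: transitive_pairs_def)
  also have "\<dots> \<le> (9 * ?D ^ 2) ^ r * 2 ^ (r + (d - 1)) * potential ?A \<rho> ?P"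
    using \<open>d > 0\<close> partition_on_cycle_sets[OF \<rho>]
    by (intro sum_potential_monotone_pairs \<rho> refines_refl) auto
  also have "potential ?A \<rho> ?P = (1 / ?D) ^ ?l"
    using potential_cycle_sets[OF \<rho>] by simp
  also have "(9 * ?D ^ 2) ^ r * 2 ^ (r + (d - 1)) * (1 / ?D) ^ ?l
      \<le> (9 * ?D ^ 2) ^ r * 2 ^ (r + d) * (1 / ?D) ^ ?l"
    by (intro mult_left_mono mult_right_mono power_increasing) auto
  also have "\<dots> = 18 ^ r * 2 ^ d * ?D ^ (2 * r) / ?D ^ ?l"
  proof -
    have "(9::real) ^ r * 2 ^ r = 18 ^ r"
      by (simp flip: power_mult_distrib)
    moreover have "(9 * ?D ^ 2) ^ r * 2 ^ (r + d) = (9 ^ r * 2 ^ r) * 2 ^ d * ?D ^ (2 * r)"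
      by (simp add: power_mult_distrib power_add power_mult)
    ultimately show ?thesis
      by (simp add: power_one_over)
  qed
  finally have "real (card ?T) * (?D ^ (2 * m) / (?D * 4 ^ d)) \<le> 18 ^ r * 2 ^ d * ?D ^ (2 * r) / ?D ^ ?l" .
  then have "real (card ?T) * (?D ^ (2 * m) / (?D * 4 ^ d)) * (?D ^ ?l * ?D * 4 ^ d)
      \<le> 18 ^ r * 2 ^ d * ?D ^ (2 * r) / ?D ^ ?l * (?D ^ ?l * ?D * 4 ^ d)"
    by (intro mult_right_mono) auto
  then have "real (card ?T) * ?D ^ (?l + 2 * m) \<le> 18 ^ r * (2 ^ d * 4 ^ d) * ?D ^ (2 * r + 1)"
    using D by (simp add: power_add ac_simps)
  also have "(2::real) ^ d * 4 ^ d = 8 ^ d"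
    by (simp flip: power_mult_distrib)
  \<comment> \<open>Giving away d^3 raises the exponent to 2r + 4, which by the relation between
    \<open>r\<close> and the genus equals 4g + 2l + 2m; then d^(l+2m) cancels.\<close>
  also have "18 ^ r * 8 ^ d * ?D ^ (2 * r + 1) \<le> 18 ^ r * 8 ^ d * ?D ^ (2 * r + 4)"
    using D by (intro mult_left_mono power_increasing) auto
  also have "2 * r + 4 = 4 * g + ?l + (?l + 2 * m)"
    using r by simp
  also have "18 ^ r * 8 ^ d * ?D ^ (4 * g + ?l + (?l + 2 * m)) =
      18 ^ r * 8 ^ d * ?D ^ (4 * g) * ?D ^ ?l * ?D ^ (?l + 2 * m)"
    by (simp only: power_add mult.assoc)
  finally show ?thesis
    by (rule mult_right_le_imp_le) (use D in simp)
qed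

section \<open>From factorizations to lists of pairs\<close>

lemma size_cycle_type: "size (cycle_type d \<sigma>) = card (cycle_sets {1..d} \<sigma>)"
  by (simp add: cycle_type_def cycle_sets_def)

lemma card_cycle_sets_bounds:
  assumes "d > 0"
  shows "card (cycle_sets {1..d} \<sigma>) \<in> {1..d}"
  using assms card_image_le[of "{1..d}" "orbit \<sigma>"] card_gt_0_iff[of "orbit \<sigma> ` {1..d}"]
  by (auto simp: cycle_sets_def)

lemma monotone_factorizations_transitive_pairs:
  assumes "(\<rho>, \<tau>s) \<in> monotone_factorizations d r \<alpha> \<beta>" "d > 0"
  shows "\<rho> permutes {1..d}" "cycle_type d \<rho> = \<alpha>" "cycle_type d (foldl (\<circ>) \<rho> \<tau>s) = \<beta>"
    and "\<tau>s \<in> map (\<lambda>(x, y). Transposition.transpose x y) ` transitive_pairs d r (size \<beta>) \<rho>"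
proof -
  show \<rho>: "\<rho> permutes {1..d}" and "cycle_type d \<rho> = \<alpha>" and \<beta>: "cycle_type d (foldl (\<circ>) \<rho> \<tau>s) = \<beta>"
    using assms by (auto simp: monotone_factorizations_def)
  obtain ps where ps: "ps \<in> monotone_pairs d 1 r"
    "\<tau>s = map (\<lambda>(x, y). Transposition.transpose x y) ps"
    using assms unfolding monotone_factorizations_def monotone_transpositions_def monotone_pairs_def
    by fastforce
  have "merge_all ps (cycle_sets {1..d} \<rho>) = {{1..d}}"
    using assms ps by (intro merge_all_transitive[OF \<rho> _ monotone_pairs_subset[OF ps(1)]])
      (auto simp: monotone_factorizations_def)
  moreover have "card (cycle_sets {1..d} (apply_swaps \<rho> ps)) = size \<beta>"
    using \<beta> size_cycle_type ps(2) by (metis apply_swaps_conv_foldl)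
  ultimately show "\<tau>s \<in> map (\<lambda>(x, y). Transposition.transpose x y) ` transitive_pairs d r (size \<beta>) \<rho>"
    using ps by (auto simp: transitive_pairs_def)
qed

text \<open>A factorization determines \<alpha> and \<beta> as the cycle types of
  \<open>\<rho>\<close> and of the product, so the double sum counts a disjoint union. It injects
  into triples that keep only \<open>\<rho>\<close>, the length of \<beta> and the
  transpositions.\<close>

lemma sum_monotone_hurwitz_le_sum_card:
  assumes "d > 0"
  shows "(\<Sum>\<alpha>\<in>int_partitions d. \<Sum>\<beta>\<in>int_partitions d. monotone_hurwitz g \<alpha> \<beta>) \<le>
    (\<Sum>\<rho> | \<rho> permutes {1..d}. \<Sum>m=1..d.
      card (transitive_pairs d (2 * g + card (cycle_sets {1..d} \<rho>) + m - 2) m \<rho>))"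
proof -
  let ?IP = "int_partitions d"
  let ?r = "\<lambda>\<alpha> \<beta>. 2 * g + size \<alpha> + size \<beta> - 2"
  let ?X = "SIGMA \<alpha>\<beta>:?IP \<times> ?IP. monotone_factorizations d (?r (fst \<alpha>\<beta>) (snd \<alpha>\<beta>)) (fst \<alpha>\<beta>) (snd \<alpha>\<beta>)"
  let ?T = "\<lambda>\<rho> m. transitive_pairs d (2 * g + card (cycle_sets {1..d} \<rho>) + m - 2) m \<rho>"
  let ?map = "map (\<lambda>(x, y). Transposition.transpose x y)"
  let ?Y = "SIGMA \<rho>:{\<rho>. \<rho> permutes {1..d}}. SIGMA m:{1..d}. ?map ` ?T \<rho> m"
  let ?\<phi> = "\<lambda>(\<alpha>\<beta> :: nat multiset \<times> nat multiset, \<rho>, \<tau>s). (\<rho>, size (snd \<alpha>\<beta>), \<tau>s)"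
  have finT: "finite (?T \<rho> m)" for \<rho> m
    by (simp add: transitive_pairs_def finite_monotone_pairs)
  have finP: "finite {\<rho>. \<rho> permutes {1..d}}"
    by (simp add: finite_permutations)
  \<comment> \<open>Only an inequality: a negative exponent makes the Hurwitz number 0, whereas the
    truncated subtraction on the right yields exponent 0.\<close>
  have "(\<Sum>\<alpha>\<in>?IP. \<Sum>\<beta>\<in>?IP. monotone_hurwitz g \<alpha> \<beta>) \<le>
      (\<Sum>\<alpha>\<in>?IP. \<Sum>\<beta>\<in>?IP. card (monotone_factorizations d (?r \<alpha> \<beta>) \<alpha> \<beta>))"
    by (intro sum_mono) (auto simp: monotone_hurwitz_def monotone_hurwitz_r_def int_partitions_def)
  also have "\<dots> = (\<Sum>\<alpha>\<beta>\<in>?IP \<times> ?IP.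
      card (monotone_factorizations d (?r (fst \<alpha>\<beta>) (snd \<alpha>\<beta>)) (fst \<alpha>\<beta>) (snd \<alpha>\<beta>)))"
    by (simp add: sum.cartesian_product case_prod_beta)
  also have "\<dots> = card ?X"
    by (rule card_SigmaI[symmetric]) (auto simp: finite_int_partitions finite_monotone_factorizations)
  also have "\<dots> \<le> card ?Y"
  proof (rule card_inj_on_le)
    show "inj_on ?\<phi> ?X"
    proof (rule inj_onI)
      fix u v assume u: "u \<in> ?X" and v: "v \<in> ?X" and eq: "?\<phi> u = ?\<phi> v"
      obtain \<alpha> \<beta> \<rho> \<tau>s where u': "u = ((\<alpha>, \<beta>), \<rho>, \<tau>s)"
        by (metis prod.exhaust)
      obtain \<alpha>' \<beta>' where v': "v = ((\<alpha>', \<beta>'), \<rho>, \<tau>s)"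
        using eq unfolding u' by (cases v) auto
      show "u = v"
      proof -
        have "(\<rho>, \<tau>s) \<in> monotone_factorizations d (?r \<alpha> \<beta>) \<alpha> \<beta>"
          "(\<rho>, \<tau>s) \<in> monotone_factorizations d (?r \<alpha>' \<beta>') \<alpha>' \<beta>'"
          using u v unfolding u' v' by auto
        then show ?thesis
          unfolding u' v' using monotone_factorizations_transitive_pairs(2,3)[OF _ assms] by metis
      qed
    qed
    show "?\<phi> ` ?X \<subseteq> ?Y"
    proof
      fix w assume "w \<in> ?\<phi> ` ?X"
      then obtain \<alpha> \<beta> \<rho> \<tau>s where w: "w = (\<rho>, size \<beta>, \<tau>s)"
        and mf: "(\<rho>, \<tau>s) \<in> monotone_factorizations d (?r \<alpha> \<beta>) \<alpha> \<beta>"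
        by auto
      note f = monotone_factorizations_transitive_pairs[OF mf assms]
      have "size \<beta> \<in> {1..d}"
        using card_cycle_sets_bounds[OF assms] f(3) size_cycle_type by metis
      moreover have "size \<alpha> = card (cycle_sets {1..d} \<rho>)"
        using f(2) size_cycle_type by metis
      ultimately show "w \<in> ?Y"
        using f(1,4) w by auto
    qed
    show "finite ?Y"
      using finT finP by (intro finite_SigmaI) auto
  qed
  also have "card ?Y = (\<Sum>\<rho> | \<rho> permutes {1..d}. \<Sum>m=1..d. card (?map ` ?T \<rho> m))"
    using finT finP by (simp add: card_SigmaI)
  also have "\<dots> \<le> (\<Sum>\<rho> | \<rho> permutes {1..d}. \<Sum>m=1..d. card (?T \<rho> m))"
    by (intro sum_mono card_image_le finT)
  finally show ?thesis .
qed

text \<open>With at most d cycles at both ends, r \<le> 2g + 2d, whence 18^(2g+2d) = 324^(g+d). The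
  sum over \<open>m\<close> gives a factor d, the sum over \<open>\<rho>\<close> a rising factorial,
  and 324 * 8 * 4 = 10368.\<close>

lemma sum_monotone_hurwitz_le:
  assumes "d > 0"
  shows "real (\<Sum>\<alpha>\<in>int_partitions d. \<Sum>\<beta>\<in>int_partitions d. monotone_hurwitz g \<alpha> \<beta>)
    \<le> 324 ^ g * real d ^ (4 * g + 1) * 10368 ^ d * fact d"
proof -
  let ?l = "\<lambda>\<rho>. card (cycle_sets {1..d} \<rho>)"
  have "real (\<Sum>\<alpha>\<in>int_partitions d. \<Sum>\<beta>\<in>int_partitions d. monotone_hurwitz g \<alpha> \<beta>) \<le>
      (\<Sum>\<rho> | \<rho> permutes {1..d}. \<Sum>m=1..d. real (card (transitive_pairs d (2 * g + ?l \<rho> + m - 2) m \<rho>)))"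
    using sum_monotone_hurwitz_le_sum_card[OF assms, of g] by (simp flip: of_nat_sum)
  also have "\<dots> \<le> (\<Sum>\<rho> | \<rho> permutes {1..d}. \<Sum>m=1..d.
      18 ^ (2 * g + 2 * d) * 8 ^ d * real d ^ (4 * g) * real d ^ ?l \<rho>)"
  proof (intro sum_mono)
    fix \<rho> m assume \<rho>: "\<rho> \<in> {\<rho>. \<rho> permutes {1..d}}" and m: "m \<in> {1..d}"
    let ?r = "2 * g + ?l \<rho> + m - 2"
    have l: "?l \<rho> \<in> {1..d}"
      by (rule card_cycle_sets_bounds[OF assms])
    then have "real (card (transitive_pairs d ?r m \<rho>)) \<le> 18 ^ ?r * 8 ^ d * real d ^ (4 * g) * real d ^ ?l \<rho>"
      using \<rho> m assms by (intro card_transitive_pairs_le) auto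
    also have "\<dots> \<le> 18 ^ (2 * g + 2 * d) * 8 ^ d * real d ^ (4 * g) * real d ^ ?l \<rho>"
      using l m by (intro mult_right_mono power_increasing) auto
    finally show "real (card (transitive_pairs d ?r m \<rho>))
        \<le> 18 ^ (2 * g + 2 * d) * 8 ^ d * real d ^ (4 * g) * real d ^ ?l \<rho>" .
  qed
  also have "\<dots> = real d * (18 ^ (2 * g + 2 * d) * 8 ^ d * real d ^ (4 * g)) *
      (\<Sum>\<rho> | \<rho> permutes {1..d}. real d ^ ?l \<rho>)"
    by (simp add: sum_distrib_left mult.assoc)
  also have "(\<Sum>\<rho> | \<rho> permutes {1..d}. real d ^ ?l \<rho>) = pochhammer (real d) d"
    using sum_permutations_power_card_cycles[of "{1..d}" "real d"] by simp
  also have "real d * (18 ^ (2 * g + 2 * d) * 8 ^ d * real d ^ (4 * g)) * pochhammer (real d) d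
      \<le> real d * (18 ^ (2 * g + 2 * d) * 8 ^ d * real d ^ (4 * g)) * (4 ^ d * fact d)"
    by (intro mult_left_mono pochhammer_self_le) auto
  also have "\<dots> = 324 ^ g * real d ^ (4 * g + 1) * (324 ^ d * 8 ^ d * 4 ^ d) * fact d"
    by (simp add: power_add power_mult)
  also have "(324::real) ^ d * 8 ^ d * 4 ^ d = 10368 ^ d"
    by (simp flip: power_mult_distrib)
  finally show ?thesis .
qed

section \<open>Convergence\<close>

text \<open>The Weierstrass M-test with a geometric majorant, after shifting the index because the
  series starts at d = 1.\<close>

lemma abs_unif_convergent_on_geometric:
  fixes C :: real
  assumes "\<And>d x. x \<in> K \<Longrightarrow> d > 0 \<Longrightarrow> norm (f d x) \<le> C * (1 / 2) ^ d"
  shows "abs_unif_convergent_on K f"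
proof -
  let ?M = "\<lambda>d. C * (1 / 2) ^ Suc d"
  have M: "summable ?M"
    by (intro summable_mult) (simp add: summable_geometric)
  have le: "norm (f (Suc d) x) \<le> ?M d" if "x \<in> K" for d x
    using assms[OF that, of "Suc d"] by simp
  have "summable (\<lambda>d. norm (f (Suc d) x))" if "x \<in> K" for x
    by (rule summable_comparison_test'[OF M, of 0]) (use le[OF that] in simp)
  moreover have "uniformly_convergent_on K (\<lambda>n x. \<Sum>d<n. f (Suc d) x)"
    by (rule Weierstrass_m_test'[OF le M])
  ultimately show ?thesis
    by (simp add: abs_unif_convergent_on_def sum.atLeast1_atMost_eq)
qed

text \<open>Each part contributes a sum of \<open>N\<close> numbers in the unit disc, matched by one
  factor \<open>N\<close> in the denominator. This is what makes the estimates independent of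
  \<open>N\<close>.\<close>

lemma norm_power_sum_poly_le:
  assumes "x \<in> unit_polydisc N" "N \<ge> 1"
  shows "norm (power_sum_poly N x \<alpha> / of_nat N ^ size \<alpha>) \<le> 1"
proof -
  have "norm (power_sum_poly N x \<alpha>) \<le> real N ^ size \<alpha>"
  proof (induction \<alpha>)
    case empty
    show ?case by (simp add: power_sum_poly_def)
  next
    case (add k \<alpha>)
    have "norm (\<Sum>j=1..N. x j ^ k) \<le> (\<Sum>j=1..N. 1)"
    proof (rule sum_norm_le)
      fix j assume "j \<in> {1..N}"
      then have "norm (x j) \<le> 1"
        using assms(1) by (auto simp: unit_polydisc_def)
      then show "norm (x j ^ k) \<le> 1"
        by (simp add: norm_power power_le_one)
    qed
    then have "norm ((\<Sum>j=1..N. x j ^ k) * power_sum_poly N x \<alpha>) \<le> real N * real N ^ size \<alpha>"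
      unfolding norm_mult using add.IH by (intro mult_mono) auto
    then show ?case
      by (simp add: power_sum_poly_def)
  qed
  then show ?thesis
    using assms(2) by (simp add: norm_divide norm_power)
qed

text \<open>The n-th power of x/n \<le> exp (x/n). It absorbs d^(4g+1) into an exponential whose
  rate does not involve \<open>g\<close>; only the constant in front does.\<close>

lemma power_le_exp:
  fixes x :: real
  assumes "x \<ge> 0" "n > 0"
  shows "x ^ n \<le> real n ^ n * exp x"
proof -
  have "x / real n \<le> exp (x / real n)"
    using exp_ge_add_one_self[of "x / real n"] by linarith
  then have "(x / real n) ^ n \<le> exp (x / real n) ^ n"
    using assms by (intro power_mono) auto
  also have "\<dots> = exp x"
    using assms by (simp flip: exp_of_nat_mult)
  finally show ?thesis
    using assms by (simp add: power_divide field_simps)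
qed

text \<open>Since exp 1 \<le> 3, the growth rate is at most 3 * 10368 = 31104. The radius 1/62208 is
  half its reciprocal, which leaves the ratio 1/2 for every \<open>g\<close>.\<close>

lemma sum_monotone_hurwitz_geometric:
  fixes t :: real
  assumes "d > 0" "0 \<le> t" "t \<le> 1 / 62208"
  shows "t ^ d / fact d * real (\<Sum>\<alpha>\<in>int_partitions d. \<Sum>\<beta>\<in>int_partitions d. monotone_hurwitz g \<alpha> \<beta>)
    \<le> 324 ^ g * real (4 * g + 1) ^ (4 * g + 1) * (1 / 2) ^ d"
proof -
  let ?K = "324 ^ g * real (4 * g + 1) ^ (4 * g + 1)"
  have "exp (real d) = exp 1 ^ d"
    by (simp flip: exp_of_nat_mult)
  also have "\<dots> \<le> 3 ^ d"
    using exp_le by (intro power_mono) auto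
  finally have "real d ^ (4 * g + 1) \<le> real (4 * g + 1) ^ (4 * g + 1) * 3 ^ d"
    using power_le_exp[of "real d" "4 * g + 1"] by (meson add_gr_0 less_one mult_left_mono of_nat_0_le_iff order_trans zero_le_power)
  then have "324 ^ g * real d ^ (4 * g + 1) * 10368 ^ d * fact d \<le>
      324 ^ g * (real (4 * g + 1) ^ (4 * g + 1) * 3 ^ d) * 10368 ^ d * fact d"
    by (intro mult_right_mono mult_left_mono) auto
  also have "\<dots> = ?K * (3 ^ d * 10368 ^ d) * fact d"
    by (simp only: ac_simps)
  also have "(3::real) ^ d * 10368 ^ d = 31104 ^ d"
    by (simp flip: power_mult_distrib)
  finally have "real (\<Sum>\<alpha>\<in>int_partitions d. \<Sum>\<beta>\<in>int_partitions d. monotone_hurwitz g \<alpha> \<beta>)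
      \<le> ?K * 31104 ^ d * fact d"
    using sum_monotone_hurwitz_le[OF assms(1), of g] by linarith
  then have "t ^ d / fact d * real (\<Sum>\<alpha>\<in>int_partitions d. \<Sum>\<beta>\<in>int_partitions d. monotone_hurwitz g \<alpha> \<beta>)
      \<le> t ^ d / fact d * (?K * 31104 ^ d * fact d)"
    using assms(2) by (intro mult_left_mono) auto
  also have "\<dots> = ?K * (t * 31104) ^ d"
    by (simp add: power_mult_distrib)
  also have "\<dots> \<le> ?K * (1 / 2) ^ d"
    using assms by (intro mult_left_mono power_mono) auto
  finally show ?thesis .
qed

lemma norm_F_term_le:
  assumes "a \<in> unit_polydisc N" "b \<in> unit_polydisc N" "N \<ge> 1" "d > 0" "norm z \<le> 1 / 62208"
  shows "norm (F_term g N d (z, a, b)) \<le> 324 ^ g * real (4 * g + 1) ^ (4 * g + 1) * (1 / 2) ^ d"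
proof -
  let ?t = "\<lambda>\<alpha> \<beta>. power_sum_poly N a \<alpha> / of_nat N ^ size \<alpha> *
        (power_sum_poly N b \<beta> / of_nat N ^ size \<beta>) *
        (-1) ^ (size \<alpha> + size \<beta>) * of_nat (monotone_hurwitz g \<alpha> \<beta>)"
  have t: "norm (?t \<alpha> \<beta>) \<le> real (monotone_hurwitz g \<alpha> \<beta>)" for \<alpha> \<beta>
  proof -
    have "norm (?t \<alpha> \<beta>) = norm (power_sum_poly N a \<alpha> / of_nat N ^ size \<alpha>) *
        norm (power_sum_poly N b \<beta> / of_nat N ^ size \<beta>) * real (monotone_hurwitz g \<alpha> \<beta>)"
      by (simp only: norm_mult norm_power norm_minus_cancel norm_one power_one norm_of_nat mult_1_right)
    also have "\<dots> \<le> 1 * 1 * real (monotone_hurwitz g \<alpha> \<beta>)"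
      using assms by (intro mult_mono norm_power_sum_poly_le) auto
    finally show ?thesis by simp
  qed
  have "norm (\<Sum>\<alpha>\<in>int_partitions d. \<Sum>\<beta>\<in>int_partitions d. ?t \<alpha> \<beta>) \<le>
      (\<Sum>\<alpha>\<in>int_partitions d. \<Sum>\<beta>\<in>int_partitions d. real (monotone_hurwitz g \<alpha> \<beta>))"
    by (intro sum_norm_le t)
  then have "norm (F_term g N d (z, a, b)) \<le> norm z ^ d / fact d *
      real (\<Sum>\<alpha>\<in>int_partitions d. \<Sum>\<beta>\<in>int_partitions d. monotone_hurwitz g \<alpha> \<beta>)"
    unfolding F_term_def prod.case norm_mult norm_divide norm_power norm_fact of_nat_sum
    by (intro mult_left_mono) auto
  also have "\<dots> \<le> 324 ^ g * real (4 * g + 1) ^ (4 * g + 1) * (1 / 2) ^ d"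
    using assms by (intro sum_monotone_hurwitz_geometric) auto
  finally show ?thesis .
qed

text \<open>The single numbers form the row \<alpha> = (1^d) of the double sum, so the bound for F
  also controls G.\<close>

lemma sum_monotone_hurwitz_single_le:
  "(\<Sum>\<beta>\<in>int_partitions d. monotone_hurwitz_single g \<beta>) \<le>
    (\<Sum>\<alpha>\<in>int_partitions d. \<Sum>\<beta>\<in>int_partitions d. monotone_hurwitz g \<alpha> \<beta>)"
proof -
  have "(\<Sum>\<beta>\<in>int_partitions d. monotone_hurwitz_single g \<beta>) =
      (\<Sum>\<beta>\<in>int_partitions d. monotone_hurwitz g (replicate_mset d 1) \<beta>)"
    by (rule sum.cong) (auto simp: monotone_hurwitz_single_def int_partitions_def)
  also have "\<dots> \<le> (\<Sum>\<alpha>\<in>int_partitions d. \<Sum>\<beta>\<in>int_partitions d. monotone_hurwitz g \<alpha> \<beta>)"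
  proof (rule member_le_sum)
    show "replicate_mset d 1 \<in> int_partitions d"
      by (auto simp: int_partitions_def)
  qed (simp_all add: finite_int_partitions)
  finally show ?thesis .
qed

lemma norm_G_term_le:
  assumes "c \<in> unit_polydisc N" "N \<ge> 1" "d > 0" "norm z \<le> 1 / 62208"
  shows "norm (G_term g N d (z, c)) \<le> 324 ^ g * real (4 * g + 1) ^ (4 * g + 1) * (1 / 2) ^ d"
proof -
  let ?t = "\<lambda>\<beta>. power_sum_poly N c \<beta> / of_nat N ^ size \<beta> *
        (-1) ^ (d + size \<beta>) * of_nat (monotone_hurwitz_single g \<beta>)"
  have t: "norm (?t \<beta>) \<le> real (monotone_hurwitz_single g \<beta>)" for \<beta>
  proof -
    have "norm (?t \<beta>) =
        norm (power_sum_poly N c \<beta> / of_nat N ^ size \<beta>) * real (monotone_hurwitz_single g \<beta>)"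
      by (simp only: norm_mult norm_power norm_minus_cancel norm_one power_one norm_of_nat mult_1_right)
    also have "\<dots> \<le> 1 * real (monotone_hurwitz_single g \<beta>)"
      using assms by (intro mult_right_mono norm_power_sum_poly_le) auto
    finally show ?thesis by simp
  qed
  have "norm (\<Sum>\<beta>\<in>int_partitions d. ?t \<beta>) \<le> (\<Sum>\<beta>\<in>int_partitions d. real (monotone_hurwitz_single g \<beta>))"
    by (intro sum_norm_le t)
  also have "\<dots> \<le> real (\<Sum>\<alpha>\<in>int_partitions d. \<Sum>\<beta>\<in>int_partitions d. monotone_hurwitz g \<alpha> \<beta>)"
    using sum_monotone_hurwitz_single_le[of g d] by (simp flip: of_nat_sum)
  finally have "norm (\<Sum>\<beta>\<in>int_partitions d. ?t \<beta>) \<le>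
      real (\<Sum>\<alpha>\<in>int_partitions d. \<Sum>\<beta>\<in>int_partitions d. monotone_hurwitz g \<alpha> \<beta>)" .
  \<comment> \<open>As |z| \<le> 1, the even powers in G are dominated by the powers in the estimate
    for F.\<close>
  moreover have "norm z ^ (2 * d) \<le> norm z ^ d"
    using assms by (intro power_decreasing) auto
  ultimately have "norm (G_term g N d (z, c)) \<le> norm z ^ d / fact d *
      real (\<Sum>\<alpha>\<in>int_partitions d. \<Sum>\<beta>\<in>int_partitions d. monotone_hurwitz g \<alpha> \<beta>)"
    unfolding G_term_def prod.case norm_mult norm_divide norm_power norm_fact
    by (intro mult_mono divide_right_mono) auto
  also have "\<dots> \<le> 324 ^ g * real (4 * g + 1) ^ (4 * g + 1) * (1 / 2) ^ d"
    using assms by (intro sum_monotone_hurwitz_geometric) auto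
  finally show ?thesis .
qed

theorem theorem4p2:
  shows "\<exists>\<delta>::real. \<delta> > 0 \<and>
    (\<forall>(g::nat) (N::nat). N \<ge> 1 \<longrightarrow>
       abs_unif_convergent_on ({z. norm z \<le> \<delta>} \<times> unit_polydisc N \<times> unit_polydisc N) (F_term g N) \<and>
       abs_unif_convergent_on ({z. norm z \<le> \<delta>} \<times> unit_polydisc N) (G_term g N))"
proof (intro exI[of _ "1 / 62208"] conjI allI impI)
  fix g N :: nat assume N: "N \<ge> 1"
  show "abs_unif_convergent_on ({z. norm z \<le> 1 / 62208} \<times> unit_polydisc N \<times> unit_polydisc N) (F_term g N)"
    by (rule abs_unif_convergent_on_geometric) (use norm_F_term_le[OF _ _ N] in blast)
  show "abs_unif_convergent_on ({z. norm z \<le> 1 / 62208} \<times> unit_polydisc N) (G_term g N)"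
    by (rule abs_unif_convergent_on_geometric) (use norm_G_term_le[OF _ N] in blast)
qed simp

end
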